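(* For every positive integer $m$, the cyclic biquandle $C_m$ of order $m$ satisfies $$H_1^{YB}(C_m)\cong\mathbb{Z}\oplus\mathbb{Z}_m,\qquad H_1^{D}(C_m)=0,\qquad H_1^{NYB}(C_m)\cong\mathbb{Z}\oplus\mathbb{Z}_m,$$ $$H_2^{YB}(C_m)\cong\mathbb{Z}^m,\qquad H_2^{D}(C_m)\cong\mathbb{Z},\qquad H_2^{NYB}(C_m)\cong\mathbb{Z}^{m-1}.$$
   Context: The cyclic biquandle $C_m$ of order $m$ is the set $\mathbb{Z}/m\mathbb{Z}$ with the map $R(a,b)=(b+1,a-1)$. Its set-theoretic Yang-Baxter chain complex: for $n\ge 1$, $C_n^{YB}(C_m)$ is the free abelian group with basis $(C_m)^n$, and $C_n^{YB}(C_m)=0$ for $n\le 0$. The boundary is $\partial_n=\sum_{i=1}^n(-1)^{i-1}(d^l_{i,n}-d^r_{i,n})$ for $n\ge 2$ (and $\partial_n=0$ for $n\le 1$), where on basis elements $$d^l_{i,n}(x_1,\ldots,x_n)=(x_1-1,\ldots,x_{i-1}-1,x_{i+1},\ldots,x_n),$$ $$d^r_{i,n}(x_1,\ldots,x_n)=(x_1,\ldots,x_{i-1},x_{i+1}+1,\ldots,x_n+1).$$ For $n\ge 2$ the degenerate subgroup $C_n^D(C_m)\subseteq C_n^{YB}(C_m)$ is spanned by the tuples $(x_1,\ldots,x_n)$ with $R(x_i,x_{i+1})=(x_i,x_{i+1})$, i.e. $x_i=x_{i+1}+1$, for some $1\le i\le n-1$; $C_n^D(C_m)=0$ for $n\le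 1$. These form a subcomplex, and $C_*^{NYB}(C_m)=C_*^{YB}(C_m)/C_*^D(C_m)$ is the quotient complex. $H_n^{YB}$, $H_n^{D}$, $H_n^{NYB}$ denote the (integral) homology groups of $C_*^{YB}$, $C_*^{D}$, $C_*^{NYB}$ respectively. $\mathbb{Z}_m$ denotes $\mathbb{Z}/m\mathbb{Z}$. *)

theory Defs
  imports "HOL-Algebra.Free_Abelian_Groups"
begin

text \<open>Elements of \<open>\<int>/m\<int>\<close> are represented by \<open>0, \<dots>, m - 1\<close>, the carrier of
  \<^const>\<open>integer_mod_group\<close> \<open>m\<close> (for \<open>m > 0\<close>).\<close>

definition cyclic_R :: "nat \<Rightarrow> int \<times> int \<Rightarrow> int \<times> int" where
  "cyclic_R m = (\<lambda>(a, b). ((b + 1) mod int m, (a - 1) mod int m))"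

text \<open>An \<open>n\<close>-tuple \<open>(x\<^sub>1, \<dots>, x\<^sub>n)\<close> is a list of length \<open>n\<close>, with \<open>x\<^sub>i\<close> being \<open>xs ! (i - 1)\<close>.
  Degrees are integers, and there are no basis elements in degrees \<open>n \<le> 0\<close>; in particular the
  empty tuple is not a basis element in degree \<open>0\<close>.\<close>

definition YB_tuples :: "nat \<Rightarrow> int \<Rightarrow> int list set" where
  "YB_tuples m n =
     {xs. 1 \<le> n \<and> int (length xs) = n \<and> set xs \<subseteq> carrier (integer_mod_group m)}"

definition D_tuples :: "nat \<Rightarrow> int \<Rightarrow> int list set" where
  "D_tuples m n =
     {xs \<in> YB_tuples m n. 2 \<le> n \<and>
        (\<exists>i\<in>{1..length xs - 1}.
           cyclic_R m (xs ! (i - 1), xs ! i) = (xs ! (i - 1), xs ! i))}"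

definition face_l :: "nat \<Rightarrow> nat \<Rightarrow> int list \<Rightarrow> int list" where
  "face_l m i xs = map (\<lambda>a. (a - 1) mod int m) (take (i - 1) xs) @ drop i xs"

definition face_r :: "nat \<Rightarrow> nat \<Rightarrow> int list \<Rightarrow> int list" where
  "face_r m i xs = take (i - 1) xs @ map (\<lambda>a. (a + 1) mod int m) (drop i xs)"

definition YB_boundary :: "nat \<Rightarrow> int \<Rightarrow> (int list \<Rightarrow>\<^sub>0 int) \<Rightarrow> (int list \<Rightarrow>\<^sub>0 int)" where
  "YB_boundary m n =
     (if 2 \<le> n
      then frag_extend (\<lambda>xs. \<Sum>i = 1..nat n.
             frag_cmul ((- 1) ^ (i - 1)) (frag_of (face_l m i xs) - frag_of (face_r m i xs)))
      else (\<lambda>c. 0))"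

definition YB_chain :: "nat \<Rightarrow> int \<Rightarrow> (int list \<Rightarrow>\<^sub>0 int) monoid" where
  "YB_chain m n = free_Abelian_group (YB_tuples m n)"

definition D_chain :: "nat \<Rightarrow> int \<Rightarrow> (int list \<Rightarrow>\<^sub>0 int) monoid" where
  "D_chain m n = subgroup_generated (YB_chain m n) (frag_of ` D_tuples m n)"

definition NYB_chain :: "nat \<Rightarrow> int \<Rightarrow> (int list \<Rightarrow>\<^sub>0 int) set monoid" where
  "NYB_chain m n = YB_chain m n Mod carrier (D_chain m n)"

text \<open>The boundary induced on the quotient: the coset of \<open>c\<close> is sent to the coset of the boundary
  of \<open>c\<close>. The set passed to \<^const>\<open>the_elem\<close> is a singleton because the boundary maps
  degenerate chains to degenerate chains.\<close>

definition NYB_boundary ::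
    "nat \<Rightarrow> int \<Rightarrow> (int list \<Rightarrow>\<^sub>0 int) set \<Rightarrow> (int list \<Rightarrow>\<^sub>0 int) set" where
  "NYB_boundary m n K =
     the_elem ((\<lambda>c. carrier (D_chain m (n - 1)) #>\<^bsub>YB_chain m (n - 1)\<^esub> YB_boundary m n c) ` K)"

definition homology_of ::
    "(int \<Rightarrow> 'a monoid) \<Rightarrow> (int \<Rightarrow> 'a \<Rightarrow> 'a) \<Rightarrow> int \<Rightarrow> 'a set monoid" where
  "homology_of C d n =
     subgroup_generated (C n) (kernel (C n) (C (n - 1)) (d n))
       Mod (d (n + 1) ` carrier (C (n + 1)))"

definition H_YB :: "int \<Rightarrow> nat \<Rightarrow> (int list \<Rightarrow>\<^sub>0 int) set monoid" where
  "H_YB n m = homology_of (YB_chain m) (YB_boundary m) n"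

definition H_D :: "int \<Rightarrow> nat \<Rightarrow> (int list \<Rightarrow>\<^sub>0 int) set monoid" where
  "H_D n m = homology_of (D_chain m) (YB_boundary m) n"

definition H_NYB :: "int \<Rightarrow> nat \<Rightarrow> (int list \<Rightarrow>\<^sub>0 int) set set monoid" where
  "H_NYB n m = homology_of (NYB_chain m) (NYB_boundary m) n"

abbreviation integer_power_group :: "nat \<Rightarrow> (nat \<Rightarrow> int) monoid" where
  "integer_power_group k \<equiv> product_group {..<k} (\<lambda>i. integer_group)"

end

(* Write f x = [x] - [x + 1]. The boundary of (x, y) is f y - f (x - 1), so in H_1 all f x agree and
   sum to zero, which gives Z + Z_m. With g (x, y) = (x, y) - (x + 1, y + 1), the boundary of
   (x, y, z) is g (y, z) - g (x - 1, z) + g (x - 1, y - 1); hence modulo boundaries the values of g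
   are differences of one function on Z/m. A 2-cycle is therefore determined modulo boundaries by
   the sums n_j of its coefficients over the diagonals y - x + 1 = j, and the only constraint on
   these sums is that m divides the sum of all j n_j; such families form a group isomorphic to Z^m.
   Degenerate 2-chains live on the diagonal j = 0, which gives H_2 of the degenerate complex, and
   passing to the quotient drops the coordinate n_0. *)

theory Submission
  imports Defs
begin

section \<open>Homology groups as images of cycles\<close>

text \<open>Every isomorphism comes from an explicit function on chains and is checked on
  representatives: the function has to be additive on cycles, to reach the whole target and to
  vanish exactly on boundaries. The delicate point is the last one in degree two. Reduction modulo
  boundaries turns a 2-chain whose n_j all vanish into a combination of values of g whose
  coefficients form a chain p on Z/m with coefficient sum zero, and p = 0 remains to be shown. The
  cycle condition makes p invariant under x -> x + 1, hence constant, and a constant with sum zero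
  vanishes because Z has no torsion. For the congruence, (x, y) is seen as an edge from x to y + 1
  on the cyclic graph Z/m: the 2-cycles are the closed combinations of edges, and n_j counts the
  edges of length j. The equation sum of j n_j = m q can be solved for n_1, whose coefficient is 1,
  so that q and the n_j with j \<noteq> 1 are free coordinates. For m = 1 the only diagonal is 0,
  and n_0 itself is the coordinate.\<close>

lemma homology_of_iso:
  assumes gC: "group (C n)" and gC': "group (C (n - 1))"
    and d: "d n \<in> hom (C n) (C (n - 1))" and gH: "group H"
    and mult: "\<And>x y. \<lbrakk>x \<in> kernel (C n) (C (n - 1)) (d n); y \<in> kernel (C n) (C (n - 1)) (d n)\<rbrakk>
                 \<Longrightarrow> \<phi> (x \<otimes>\<^bsub>C n\<^esub> y) = \<phi> x \<otimes>\<^bsub>H\<^esub> \<phi> y"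
    and onto: "\<phi> ` kernel (C n) (C (n - 1)) (d n) = carrier H"
    and bd: "d (n + 1) ` carrier (C (n + 1)) \<subseteq> kernel (C n) (C (n - 1)) (d n)"
    and ker: "\<And>x. x \<in> kernel (C n) (C (n - 1)) (d n)
                 \<Longrightarrow> \<phi> x = \<one>\<^bsub>H\<^esub> \<longleftrightarrow> x \<in> d (n + 1) ` carrier (C (n + 1))"
  shows "homology_of C d n \<cong> H" and "group (homology_of C d n)"
proof -
  let ?Z = "kernel (C n) (C (n - 1)) (d n)"
  let ?G = "subgroup_generated (C n) ?Z"
  have "group_hom (C n) (C (n - 1)) (d n)"
    using gC gC' d by (simp add: group_hom_def group_hom_axioms_def)
  then have sub: "subgroup ?Z (C n)"
    by (rule group_hom.subgroup_kernel)
  then have carr: "carrier ?G = ?Z"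
    by (rule subgroup.carrier_subgroup_generated_subgroup)
  have gG: "group ?G"
    using gC by (rule group.group_subgroup_generated)
  have "\<phi> \<in> hom ?G H"
    using onto by (auto simp: hom_def carr mult)
  then interpret h: group_hom ?G H \<phi>
    using gG gH by (simp add: group_hom_def group_hom_axioms_def)
  \<comment> \<open>On the group of cycles the kernel of \<open>\<phi>\<close> is the group of
    boundaries, so the homology group is the quotient in the first isomorphism theorem.\<close>
  have "kernel ?G H \<phi> = d (n + 1) ` carrier (C (n + 1))"
    using bd by (auto simp: kernel_def[of ?G] carr ker)
  then have eq: "homology_of C d n = ?G Mod kernel ?G H \<phi>"
    by (simp add: homology_of_def)
  show "homology_of C d n \<cong> H"
    unfolding eq by (rule h.FactGroup_iso) (simp only: carr onto)
  show "group (homology_of C d n)"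
    unfolding eq by (rule normal.factorgroup_is_group[OF h.normal_kernel])
qed

section \<open>Chains described by their supports\<close>

abbreviation keys :: "('a \<Rightarrow>\<^sub>0 int) \<Rightarrow> 'a set" where
  "keys \<equiv> Poly_Mapping.keys"

lemma keys_diff_subset: "keys a \<subseteq> S \<Longrightarrow> keys b \<subseteq> S \<Longrightarrow> keys (a - b) \<subseteq> S"
  using keys_diff[of a b] by blast

lemma keys_add_subset: "keys a \<subseteq> S \<Longrightarrow> keys b \<subseteq> S \<Longrightarrow> keys (a + b) \<subseteq> S"
  using Poly_Mapping.keys_add[of a b] by blast

lemma keys_cmul_subset: "keys a \<subseteq> S \<Longrightarrow> keys (frag_cmul k a) \<subseteq> S"
  using keys_cmul[of k a] by blast

lemma keys_sum_subset: "(\<And>i. i \<in> I \<Longrightarrow> keys (f i) \<subseteq> S) \<Longrightarrow> keys (sum f I) \<subseteq> S"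
  using keys_sum[of f I] by blast

lemma keys_frag_extend_subset:
  "keys c \<subseteq> S \<Longrightarrow> (\<And>x. x \<in> S \<Longrightarrow> keys (f x) \<subseteq> T) \<Longrightarrow> keys (frag_extend f c) \<subseteq> T"
  using keys_frag_extend[of f c] by blast

lemmas keys_subset_intros =
  keys_diff_subset keys_add_subset keys_cmul_subset keys_sum_subset keys_frag_extend_subset

text \<open>The chains supported on \<open>T\<close> form a subgroup containing the generators, and
  each of them arises from 0 and generators by taking differences. Membership in the degenerate
  subgroup thereby becomes a condition on \<open>keys\<close>.\<close>

lemma carrier_subgroup_generated_free:
  assumes "T \<subseteq> S"
  shows "carrier (subgroup_generated (free_Abelian_group S) (frag_of ` T)) = {c. keys c \<subseteq> T}"
proof
  interpret group "free_Abelian_group S" by simp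
  have "subgroup {c. keys c \<subseteq> T} (free_Abelian_group S)"
  proof (rule subgroupI)
    show "{c. keys c \<subseteq> T} \<subseteq> carrier (free_Abelian_group S)"
      using assms by auto
    have "keys (0 :: 'a \<Rightarrow>\<^sub>0 int) \<subseteq> T" by simp
    then show "{c. keys c \<subseteq> T} \<noteq> {}" by blast
    show "inv\<^bsub>free_Abelian_group S\<^esub> a \<in> {c. keys c \<subseteq> T}" if "a \<in> {c. keys c \<subseteq> T}" for a
      using that assms by simp
  qed (simp add: keys_add_subset)
  moreover have "frag_of ` T \<subseteq> {c. keys c \<subseteq> T}"
    by auto
  ultimately show "carrier (subgroup_generated (free_Abelian_group S) (frag_of ` T)) \<subseteq> {c. keys c \<subseteq> T}"
    unfolding carrier_subgroup_generated
    by (meson generate_subgroup_incl inf_le2 order_trans)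
  interpret K: group "subgroup_generated (free_Abelian_group S) (frag_of ` T)"
    by (rule group_subgroup_generated)
  have "c \<in> carrier (subgroup_generated (free_Abelian_group S) (frag_of ` T))" if "keys c \<subseteq> T" for c
    using that
  proof (induction c rule: frag_induction)
    case zero
    show ?case using K.one_closed by simp
  next
    case (one x)
    then show ?case
      using assms by (auto simp: carrier_subgroup_generated intro!: generate.incl)
  next
    case (diff a b)
    then have b: "keys b \<subseteq> S"
      using subsetD[OF carrier_subgroup_generated_subset diff(2)] by simp
    have "inv\<^bsub>subgroup_generated (free_Abelian_group S) (frag_of ` T)\<^esub> b = - b"
      using diff b by (simp add: inv_subgroup_generated)
    with K.m_closed[OF diff(1) K.inv_closed[OF diff(2)]] show ?case by simp
  qed
  then show "{c. keys c \<subseteq> T} \<subseteq> carrier (subgroup_generated (free_Abelian_group S) (frag_of ` T))"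
    by blast
qed

section \<open>The chain groups and the boundary homomorphism\<close>

lemma D_tuples_subset: "D_tuples m n \<subseteq> YB_tuples m n"
  by (auto simp: D_tuples_def)

lemma carrier_YB_chain [simp]: "carrier (YB_chain m n) = {c. keys c \<subseteq> YB_tuples m n}"
  by (auto simp: YB_chain_def)

lemma mult_YB_chain [simp]: "x \<otimes>\<^bsub>YB_chain m n\<^esub> y = x + y"
  by (simp add: YB_chain_def)

lemma one_YB_chain [simp]: "\<one>\<^bsub>YB_chain m n\<^esub> = 0"
  by (simp add: YB_chain_def)

lemma comm_group_YB_chain: "comm_group (YB_chain m n)"
  by (simp add: YB_chain_def abelian_free_Abelian_group)

lemma group_YB_chain: "group (YB_chain m n)"
  by (simp add: YB_chain_def)

lemma carrier_D_chain [simp]: "carrier (D_chain m n) = {c. keys c \<subseteq> D_tuples m n}"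
  by (simp add: D_chain_def YB_chain_def carrier_subgroup_generated_free D_tuples_subset)

lemma mult_D_chain [simp]: "x \<otimes>\<^bsub>D_chain m n\<^esub> y = x + y"
  by (simp add: D_chain_def)

lemma one_D_chain [simp]: "\<one>\<^bsub>D_chain m n\<^esub> = 0"
  by (simp add: D_chain_def)

lemma group_D_chain: "group (D_chain m n)"
  by (simp add: D_chain_def group.group_subgroup_generated group_YB_chain)

lemma normal_D_chain: "normal (carrier (D_chain m n)) (YB_chain m n)"
proof -
  interpret comm_group "YB_chain m n" by (rule comm_group_YB_chain)
  have "subgroup (carrier (D_chain m n)) (YB_chain m n)"
    unfolding D_chain_def by (rule subgroup_subgroup_generated)
  then show ?thesis by (simp add: normal_iff_subgroup)
qed

lemma YB_boundary_diff: "YB_boundary m n (x - y) = YB_boundary m n x - YB_boundary m n y"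
  by (simp add: YB_boundary_def frag_extend_diff)

lemma YB_boundary_add: "YB_boundary m n (x + y) = YB_boundary m n x + YB_boundary m n y"
  by (simp add: YB_boundary_def frag_extend_add)

lemma YB_boundary_cmul: "YB_boundary m n (frag_cmul k x) = frag_cmul k (YB_boundary m n x)"
  by (simp add: YB_boundary_def frag_extend_cmul)

lemma YB_boundary_0 [simp]: "YB_boundary m n 0 = 0"
  by (simp add: YB_boundary_def)

lemma face_in_YB_tuples:
  assumes "xs \<in> YB_tuples m n" "2 \<le> n" "1 \<le> i" "i \<le> nat n" "0 < m"
  shows "face_l m i xs \<in> YB_tuples m (n - 1)" "face_r m i xs \<in> YB_tuples m (n - 1)"
  using assms
  by (auto simp: YB_tuples_def face_l_def face_r_def carrier_integer_mod_group
        dest!: in_set_takeD in_set_dropD)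

lemma keys_YB_boundary:
  assumes "keys c \<subseteq> YB_tuples m n" "0 < m"
  shows "keys (YB_boundary m n c) \<subseteq> YB_tuples m (n - 1)"
proof (cases "2 \<le> n")
  case True
  then show ?thesis
    unfolding YB_boundary_def
    by (simp, intro keys_subset_intros) (use assms face_in_YB_tuples in \<open>auto\<close>)
qed (simp add: YB_boundary_def)

section \<open>Isomorphism criteria for the three homology theories\<close>

lemma H_YB_iso:
  assumes m: "0 < m" and H: "group H"
    and mult: "\<And>x y. \<lbrakk>keys x \<subseteq> YB_tuples m n; YB_boundary m n x = 0;
                 keys y \<subseteq> YB_tuples m n; YB_boundary m n y = 0\<rbrakk> \<Longrightarrow> \<phi> (x + y) = \<phi> x \<otimes>\<^bsub>H\<^esub> \<phi> y"
    and onto: "\<phi> ` {x. keys x \<subseteq> YB_tuples m n \<and> YB_boundary m n x = 0} = carrier H"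
    and bd: "\<And>e. keys e \<subseteq> YB_tuples m (n + 1) \<Longrightarrow> YB_boundary m n (YB_boundary m (n + 1) e) = 0"
    and ker: "\<And>x. \<lbrakk>keys x \<subseteq> YB_tuples m n; YB_boundary m n x = 0\<rbrakk> \<Longrightarrow>
                \<phi> x = \<one>\<^bsub>H\<^esub> \<longleftrightarrow> (\<exists>e. keys e \<subseteq> YB_tuples m (n + 1) \<and> x = YB_boundary m (n + 1) e)"
  shows "H_YB n m \<cong> H"
proof -
  have Z: "kernel (YB_chain m n) (YB_chain m (n - 1)) (YB_boundary m n)
      = {x. keys x \<subseteq> YB_tuples m n \<and> YB_boundary m n x = 0}"
    by (auto simp: kernel_def)
  show ?thesis
    unfolding H_YB_def
  proof (rule homology_of_iso(1)[where \<phi> = \<phi>], unfold Z)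
    show "YB_boundary m n \<in> hom (YB_chain m n) (YB_chain m (n - 1))"
      using m by (auto simp: hom_def YB_boundary_add intro: keys_YB_boundary[THEN subsetD])
    show "YB_boundary m (n + 1) ` carrier (YB_chain m (n + 1))
        \<subseteq> {x. keys x \<subseteq> YB_tuples m n \<and> YB_boundary m n x = 0}"
      using m bd keys_YB_boundary[of _ m "n + 1"] by auto
  qed (auto simp: group_YB_chain H mult onto ker)
qed

lemma H_D_iso:
  assumes H: "group H"
    and D: "\<And>c. keys c \<subseteq> D_tuples m n \<Longrightarrow> keys (YB_boundary m n c) \<subseteq> D_tuples m (n - 1)"
    and D': "\<And>c. keys c \<subseteq> D_tuples m (n + 1) \<Longrightarrow> keys (YB_boundary m (n + 1) c) \<subseteq> D_tuples m n"
    and mult: "\<And>x y. \<lbrakk>keys x \<subseteq> D_tuples m n; YB_boundary m n x = 0;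
                 keys y \<subseteq> D_tuples m n; YB_boundary m n y = 0\<rbrakk> \<Longrightarrow> \<phi> (x + y) = \<phi> x \<otimes>\<^bsub>H\<^esub> \<phi> y"
    and onto: "\<phi> ` {x. keys x \<subseteq> D_tuples m n \<and> YB_boundary m n x = 0} = carrier H"
    and bd: "\<And>e. keys e \<subseteq> D_tuples m (n + 1) \<Longrightarrow> YB_boundary m n (YB_boundary m (n + 1) e) = 0"
    and ker: "\<And>x. \<lbrakk>keys x \<subseteq> D_tuples m n; YB_boundary m n x = 0\<rbrakk> \<Longrightarrow>
                \<phi> x = \<one>\<^bsub>H\<^esub> \<longleftrightarrow> (\<exists>e. keys e \<subseteq> D_tuples m (n + 1) \<and> x = YB_boundary m (n + 1) e)"
  shows "H_D n m \<cong> H" and "group (H_D n m)"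
proof -
  have Z: "kernel (D_chain m n) (D_chain m (n - 1)) (YB_boundary m n)
      = {x. keys x \<subseteq> D_tuples m n \<and> YB_boundary m n x = 0}"
    by (auto simp: kernel_def)
  have 1: "YB_boundary m n \<in> hom (D_chain m n) (D_chain m (n - 1))"
    by (auto simp: hom_def YB_boundary_add intro: D[THEN subsetD])
  have 2: "YB_boundary m (n + 1) ` carrier (D_chain m (n + 1))
        \<subseteq> {x. keys x \<subseteq> D_tuples m n \<and> YB_boundary m n x = 0}"
    using bd D' by auto
  show "H_D n m \<cong> H"
    unfolding H_D_def
    by (rule homology_of_iso(1)[where \<phi> = \<phi>], unfold Z)
      (use 1 2 in \<open>auto simp: group_D_chain H mult onto ker\<close>)
  show "group (H_D n m)"
    unfolding H_D_def
    by (rule homology_of_iso(2)[where \<phi> = \<phi> and H = H], unfold Z)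
      (use 1 2 in \<open>auto simp: group_D_chain H mult onto ker\<close>)
qed

text \<open>Phrased on representatives: a cycle of the quotient complex is a chain with degenerate
  boundary, and it bounds if it differs from a boundary by a degenerate chain. By
  \<open>ker\<close>, \<open>\<phi>\<close> is trivial on degenerate chains, hence constant on the
  cosets of such cycles.\<close>

lemma H_NYB_iso:
  assumes m: "0 < m" and H: "group H"
    and D: "\<And>c. keys c \<subseteq> D_tuples m n \<Longrightarrow> keys (YB_boundary m n c) \<subseteq> D_tuples m (n - 1)"
    and D': "\<And>c. keys c \<subseteq> D_tuples m (n + 1) \<Longrightarrow> keys (YB_boundary m (n + 1) c) \<subseteq> D_tuples m n"
    and mult: "\<And>x y. \<lbrakk>keys x \<subseteq> YB_tuples m n; keys (YB_boundary m n x) \<subseteq> D_tuples m (n - 1);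
                 keys y \<subseteq> YB_tuples m n; keys (YB_boundary m n y) \<subseteq> D_tuples m (n - 1)\<rbrakk>
                 \<Longrightarrow> \<phi> (x + y) = \<phi> x \<otimes>\<^bsub>H\<^esub> \<phi> y"
    and onto: "\<phi> ` {x. keys x \<subseteq> YB_tuples m n \<and> keys (YB_boundary m n x) \<subseteq> D_tuples m (n - 1)}
                 = carrier H"
    and bd: "\<And>e. keys e \<subseteq> YB_tuples m (n + 1)
                 \<Longrightarrow> keys (YB_boundary m n (YB_boundary m (n + 1) e)) \<subseteq> D_tuples m (n - 1)"
    and ker: "\<And>x. \<lbrakk>keys x \<subseteq> YB_tuples m n; keys (YB_boundary m n x) \<subseteq> D_tuples m (n - 1)\<rbrakk> \<Longrightarrow>
                \<phi> x = \<one>\<^bsub>H\<^esub> \<longleftrightarrow>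
                (\<exists>e. keys e \<subseteq> YB_tuples m (n + 1) \<and> keys (x - YB_boundary m (n + 1) e) \<subseteq> D_tuples m n)"
  shows "H_NYB n m \<cong> H"
proof -
  define cos where "cos k c = {x. keys (x - c) \<subseteq> D_tuples m k}" for k and c :: "int list \<Rightarrow>\<^sub>0 int"
  have rcos: "carrier (D_chain m k) #>\<^bsub>YB_chain m k\<^esub> c = cos k c" for k c
  proof -
    have "x \<in> carrier (D_chain m k) #>\<^bsub>YB_chain m k\<^esub> c \<longleftrightarrow> (\<exists>h. keys h \<subseteq> D_tuples m k \<and> x = h + c)" for x
      by (auto simp: r_coset_def)
    moreover have "(\<exists>h. keys h \<subseteq> D_tuples m k \<and> x = h + c) \<longleftrightarrow> keys (x - c) \<subseteq> D_tuples m k" for x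
      by (metis add_diff_cancel diff_add_cancel)
    ultimately show ?thesis by (auto simp: cos_def)
  qed
  have carr: "carrier (NYB_chain m k) = cos k ` {c. keys c \<subseteq> YB_tuples m k}" for k
    by (auto simp: NYB_chain_def carrier_FactGroup rcos simp del: carrier_D_chain)
  have cos_mult: "cos k x \<otimes>\<^bsub>NYB_chain m k\<^esub> cos k y = cos k (x + y)"
    if "keys x \<subseteq> YB_tuples m k" "keys y \<subseteq> YB_tuples m k" for k x y
    using normal.rcos_sum[OF normal_D_chain, of x m k y] that
    by (simp add: NYB_chain_def rcos del: carrier_D_chain)
  have cos_one: "\<one>\<^bsub>NYB_chain m k\<^esub> = cos k 0" for k
    by (auto simp: NYB_chain_def cos_def)
  have cos_eq: "cos k x = cos k y \<longleftrightarrow> keys (x - y) \<subseteq> D_tuples m k" for k x y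
  proof
    assume "cos k x = cos k y"
    moreover have "x \<in> cos k x" by (simp add: cos_def)
    ultimately show "keys (x - y) \<subseteq> D_tuples m k" by (auto simp: cos_def)
  next
    assume a: "keys (x - y) \<subseteq> D_tuples m k"
    have "keys (z - x) \<subseteq> D_tuples m k \<longleftrightarrow> keys (z - y) \<subseteq> D_tuples m k" for z
      using keys_add_subset[OF _ a, of "z - x"] keys_diff_subset[OF _ a, of "z - y"] by auto
    then show "cos k x = cos k y" by (simp add: cos_def)
  qed
  have bdy: "NYB_boundary m k (cos k c) = cos (k - 1) (YB_boundary m k c)"
    if Dk: "\<And>c. keys c \<subseteq> D_tuples m k \<Longrightarrow> keys (YB_boundary m k c) \<subseteq> D_tuples m (k - 1)" for k c
  proof -
    \<comment> \<open>Both \<open>x - c\<close> and its boundary are degenerate, so all elements of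
      the coset give the same value and \<open>the_elem\<close> is applied to a singleton.\<close>
    have "cos (k - 1) (YB_boundary m k x) = cos (k - 1) (YB_boundary m k c)" if "x \<in> cos k c" for x
      using Dk[of "x - c"] that by (simp add: cos_eq) (simp add: cos_def YB_boundary_diff)
    moreover have "c \<in> cos k c" by (simp add: cos_def)
    then have "cos k c \<noteq> {}" by blast
    ultimately show ?thesis
      unfolding NYB_boundary_def rcos by (intro the_elem_image_unique)
  qed
  let ?Zc = "{x. keys x \<subseteq> YB_tuples m n \<and> keys (YB_boundary m n x) \<subseteq> D_tuples m (n - 1)}"
  have Z: "kernel (NYB_chain m n) (NYB_chain m (n - 1)) (NYB_boundary m n) = cos n ` ?Zc"
    unfolding kernel_def carr cos_one Compr_image_eq by (simp add: bdy[OF D] cos_eq)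
  have im: "NYB_boundary m (n + 1) ` carrier (NYB_chain m (n + 1))
      = cos n ` YB_boundary m (n + 1) ` {e. keys e \<subseteq> YB_tuples m (n + 1)}"
    unfolding carr image_image using bdy[of "n + 1"] D' by simp
  have zero: "\<phi> x = \<one>\<^bsub>H\<^esub>" if "keys x \<subseteq> D_tuples m n" for x
  proof -
    have "keys x \<subseteq> YB_tuples m n" using that D_tuples_subset by blast
    \<comment> \<open>The witness 0 works: a degenerate chain differs from the zero boundary by a
      degenerate chain.\<close>
    moreover have "\<exists>e. keys e \<subseteq> YB_tuples m (n + 1) \<and> keys (x - YB_boundary m (n + 1) e) \<subseteq> D_tuples m n"
      by (rule exI[of _ 0]) (simp add: that)
    ultimately show ?thesis using ker[OF _ D[OF that]] by blast
  qed
  have well: "\<phi> x = \<phi> y" if "x \<in> cos n y" "y \<in> ?Zc" for x y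
  proof -
    have xy: "keys (x - y) \<subseteq> D_tuples m n" using that by (simp add: cos_def)
    then have "\<phi> (y + (x - y)) = \<phi> y \<otimes>\<^bsub>H\<^esub> \<phi> (x - y)"
      using that D_tuples_subset[of m n] D[OF xy] by (intro mult) auto
    moreover have "\<phi> y \<in> carrier H" using that onto by blast
    ultimately show ?thesis using zero[OF xy] H by (simp add: group.is_monoid)
  qed
  \<comment> \<open>The map induced by \<open>\<phi>\<close> on cosets; it is evaluated only on
    cosets of chains in \<open>?Zc\<close>, where \<open>\<phi>\<close> is constant.\<close>
  define \<psi> where "\<psi> K = the_elem (\<phi> ` K)" for K
  have \<psi>: "\<psi> (cos n c) = \<phi> c" if "c \<in> ?Zc" for c
  proof -
    have "c \<in> cos n c" by (simp add: cos_def)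
    then have "cos n c \<noteq> {}" by blast
    then show ?thesis
      unfolding \<psi>_def using well[OF _ that] by (rule the_elem_image_unique)
  qed
  show ?thesis
    unfolding H_NYB_def
  proof (rule homology_of_iso(1)[where \<phi> = \<psi>], unfold Z)
    show "group (NYB_chain m n)" "group (NYB_chain m (n - 1))"
      unfolding NYB_chain_def by (rule normal.factorgroup_is_group[OF normal_D_chain])+
    show "NYB_boundary m n \<in> hom (NYB_chain m n) (NYB_chain m (n - 1))"
    proof (rule homI)
      fix x y assume "x \<in> carrier (NYB_chain m n)" "y \<in> carrier (NYB_chain m n)"
      then obtain a b where ab: "x = cos n a" "y = cos n b" "keys a \<subseteq> YB_tuples m n" "keys b \<subseteq> YB_tuples m n"
        unfolding carr by blast
      with m have "keys (YB_boundary m n a) \<subseteq> YB_tuples m (n - 1)" "keys (YB_boundary m n b) \<subseteq> YB_tuples m (n - 1)"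
        by (simp_all add: keys_YB_boundary)
      with ab show "NYB_boundary m n (x \<otimes>\<^bsub>NYB_chain m n\<^esub> y)
          = NYB_boundary m n x \<otimes>\<^bsub>NYB_chain m (n - 1)\<^esub> NYB_boundary m n y"
          and "NYB_boundary m n x \<in> carrier (NYB_chain m (n - 1))"
        by (simp_all add: carr bdy[OF D] cos_mult YB_boundary_add)
    qed
    show "group H" by (rule H)
    show "\<psi> (x \<otimes>\<^bsub>NYB_chain m n\<^esub> y) = \<psi> x \<otimes>\<^bsub>H\<^esub> \<psi> y" if "x \<in> cos n ` ?Zc" "y \<in> cos n ` ?Zc" for x y
    proof -
      from that obtain a b where ab: "x = cos n a" "y = cos n b" "a \<in> ?Zc" "b \<in> ?Zc" by blast
      then have "a + b \<in> ?Zc" by (simp add: keys_add_subset YB_boundary_add)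
      with ab show ?thesis using mult[of a b] \<psi>[of a] \<psi>[of b] \<psi>[of "a + b"] by (simp add: cos_mult)
    qed
    have "\<psi> ` cos n ` ?Zc = \<phi> ` ?Zc" unfolding image_image by (rule image_cong) (simp_all add: \<psi>)
    then show "\<psi> ` cos n ` ?Zc = carrier H" using onto by simp
    show "NYB_boundary m (n + 1) ` carrier (NYB_chain m (n + 1)) \<subseteq> cos n ` ?Zc"
      unfolding im using bd m keys_YB_boundary[of _ m "n + 1"] by auto
    show "\<psi> x = \<one>\<^bsub>H\<^esub> \<longleftrightarrow> x \<in> NYB_boundary m (n + 1) ` carrier (NYB_chain m (n + 1))"
      if "x \<in> cos n ` ?Zc" for x
    proof -
      from that obtain a where a: "x = cos n a" "a \<in> ?Zc" by blast
      then show ?thesis unfolding im using ker[of a] \<psi>[of a] by (simp add: image_iff cos_eq Bex_def) blast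
    qed
  qed
qed

section \<open>Low-degree chains of the cyclic biquandle\<close>

definition weighted_sum :: "('a \<Rightarrow> int) \<Rightarrow> ('a \<Rightarrow>\<^sub>0 int) \<Rightarrow> int" where
  "weighted_sum w c = (\<Sum>x\<in>keys c. Poly_Mapping.lookup c x * w x)"

text \<open>A homomorphism to the integers is a homomorphism to the free abelian group on one
  generator; in this form additivity is inherited from \<open>frag_extend\<close>.\<close>

lemma weighted_sum_eq_lookup:
  "weighted_sum w c = Poly_Mapping.lookup (frag_extend (\<lambda>x. frag_cmul (w x) (frag_of ())) c) ()"
  by (simp add: weighted_sum_def frag_extend_def lookup_sum)

lemma weighted_sum_of [simp]: "weighted_sum w (frag_of x) = w x"
  by (simp add: weighted_sum_def)

lemma weighted_sum_0 [simp]: "weighted_sum w 0 = 0"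
  by (simp add: weighted_sum_def)

lemma weighted_sum_diff: "weighted_sum w (x - y) = weighted_sum w x - weighted_sum w y"
  by (simp add: weighted_sum_eq_lookup frag_extend_diff lookup_minus)

lemma weighted_sum_add: "weighted_sum w (x + y) = weighted_sum w x + weighted_sum w y"
  by (simp add: weighted_sum_eq_lookup frag_extend_add lookup_add)

lemma weighted_sum_cmul: "weighted_sum w (frag_cmul k x) = k * weighted_sum w x"
  by (simp add: weighted_sum_eq_lookup frag_extend_cmul)

lemma weighted_sum_sum: "weighted_sum w (sum f I) = (\<Sum>i\<in>I. weighted_sum w (f i))"
  by (induction I rule: infinite_finite_induct) (simp_all add: weighted_sum_add)

lemmas weighted_sum_simps =
  weighted_sum_diff weighted_sum_add weighted_sum_cmul weighted_sum_sum

lemmas frag_extend_simps = frag_extend_diff frag_extend_add frag_extend_cmul frag_extend_minus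

section \<open>Basis elements and degenerate tuples in degrees one to three\<close>

locale cyclic_biquandle =
  fixes m :: nat
  assumes m_pos: "0 < m"
begin

text \<open>Reduction modulo \<open>m\<close> is built into the basis elements, here and in
  \<open>e2\<close> and \<open>e3\<close>, so that entries range over all integers and a shift needs
  no case distinction where it wraps around.\<close>

definition e1 :: "int \<Rightarrow> int list \<Rightarrow>\<^sub>0 int" where
  "e1 x = frag_of [x mod int m]"

definition e2 :: "int \<Rightarrow> int \<Rightarrow> int list \<Rightarrow>\<^sub>0 int" where
  "e2 x y = frag_of [x mod int m, y mod int m]"

definition e3 :: "int \<Rightarrow> int \<Rightarrow> int \<Rightarrow> int list \<Rightarrow>\<^sub>0 int" where
  "e3 x y z = frag_of [x mod int m, y mod int m, z mod int m]"

definition g :: "int \<Rightarrow> int \<Rightarrow> int list \<Rightarrow>\<^sub>0 int" where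
  "g x y = e2 x y - e2 (x + 1) (y + 1)"

lemma e1_mod [simp]: "e1 (x mod int m) = e1 x" "e1 (x mod int m + y) = e1 (x + y)"
  "e1 (x mod int m - y) = e1 (x - y)"
  by (simp_all add: e1_def mod_simps)

lemma e2_mod [simp]: "e2 (x mod int m) y = e2 x y" "e2 x (y mod int m) = e2 x y"
  by (simp_all add: e2_def)

lemma mod_in_range: "0 \<le> x mod int m \<and> x mod int m < int m"
  using m_pos by simp

lemma YB_tuples_1: "YB_tuples m 1 = {[x mod int m] | x. True}"
proof -
  have "xs \<in> YB_tuples m 1 \<longleftrightarrow> (\<exists>x. xs = [x mod int m])" for xs
  proof
    assume "xs \<in> YB_tuples m 1"
    then obtain x where "xs = [x]" "0 \<le> x" "x < int m"
      using m_pos by (auto simp: YB_tuples_def carrier_integer_mod_group length_Suc_conv)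
    then have "xs = [x mod int m]" by simp
    then show "\<exists>x. xs = [x mod int m]" ..
  qed (use m_pos in \<open>auto simp: YB_tuples_def carrier_integer_mod_group\<close>)
  then show ?thesis by blast
qed

lemma YB_tuples_2: "YB_tuples m 2 = {[x mod int m, y mod int m] | x y. True}"
proof -
  have "xs \<in> YB_tuples m 2 \<longleftrightarrow> (\<exists>x y. xs = [x mod int m, y mod int m])" for xs
  proof
    assume *: "xs \<in> YB_tuples m 2"
    then have "length xs = Suc (Suc 0)" by (simp add: YB_tuples_def)
    then obtain x y where "xs = [x, y]"
      by (auto simp: length_Suc_conv)
    moreover from this * have "0 \<le> x" "x < int m" "0 \<le> y" "y < int m"
      using m_pos by (auto simp: YB_tuples_def carrier_integer_mod_group)
    ultimately have "xs = [x mod int m, y mod int m]" by simp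
    then show "\<exists>x y. xs = [x mod int m, y mod int m]" by blast
  qed (use m_pos in \<open>auto simp: YB_tuples_def carrier_integer_mod_group\<close>)
  then show ?thesis by blast
qed

lemma YB_tuples_3: "YB_tuples m 3 = {[x mod int m, y mod int m, z mod int m] | x y z. True}"
proof -
  have "xs \<in> YB_tuples m 3 \<longleftrightarrow> (\<exists>x y z. xs = [x mod int m, y mod int m, z mod int m])" for xs
  proof
    assume *: "xs \<in> YB_tuples m 3"
    then have "length xs = Suc (Suc (Suc 0))" by (simp add: YB_tuples_def)
    then obtain x y z where "xs = [x, y, z]"
      by (auto simp: length_Suc_conv)
    moreover from this * have "0 \<le> x" "x < int m" "0 \<le> y" "y < int m" "0 \<le> z" "z < int m"
      using m_pos by (auto simp: YB_tuples_def carrier_integer_mod_group)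
    ultimately have "xs = [x mod int m, y mod int m, z mod int m]" by simp
    then show "\<exists>x y z. xs = [x mod int m, y mod int m, z mod int m]" by blast
  qed (use m_pos in \<open>auto simp: YB_tuples_def carrier_integer_mod_group\<close>)
  then show ?thesis by blast
qed

lemma D_tuples_1: "D_tuples m 1 = {}"
  by (simp add: D_tuples_def)

text \<open>Of the two equations for a fixed pair, the second follows from the first by subtracting
  1.\<close>

lemma cyclic_R_fixed_iff:
  "cyclic_R m (x mod int m, y mod int m) = (x mod int m, y mod int m)
     \<longleftrightarrow> x mod int m = (y + 1) mod int m"
proof -
  have "(x - 1) mod int m = y mod int m" if "x mod int m = (y + 1) mod int m"
    using mod_diff_cong[OF that refl, of 1] by simp
  then show ?thesis by (auto simp: cyclic_R_def mod_simps)
qed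

lemma D_tuples_2: "D_tuples m 2 = {[(y + 1) mod int m, y mod int m] | y. True}"
proof -
  have "D_tuples m 2 = {[x mod int m, y mod int m] | x y. x mod int m = (y + 1) mod int m}"
    unfolding D_tuples_def YB_tuples_2
    using cyclic_R_fixed_iff by fastforce
  then show ?thesis by (auto; metis)
qed

lemma D_tuples_3: "D_tuples m 3 =
  {[(y + 1) mod int m, y mod int m, z mod int m] | y z. True} \<union>
  {[x mod int m, (z + 1) mod int m, z mod int m] | x z. True}"
proof -
  have interval: "{1..length [a, b, c] - 1} = {1, 2}" for a b c :: int
    by auto
  have iff: "[x mod int m, y mod int m, z mod int m] \<in> D_tuples m 3 \<longleftrightarrow>
      x mod int m = (y + 1) mod int m \<or> y mod int m = (z + 1) mod int m" for x y z
  proof -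
    have "[x mod int m, y mod int m, z mod int m] \<in> YB_tuples m 3"
      unfolding YB_tuples_3 by blast
    then show ?thesis
      unfolding D_tuples_def mem_Collect_eq interval by (simp add: cyclic_R_fixed_iff)
  qed
  have "xs \<in> D_tuples m 3 \<longleftrightarrow> (\<exists>y z. xs = [(y + 1) mod int m, y mod int m, z mod int m]) \<or>
      (\<exists>x z. xs = [x mod int m, (z + 1) mod int m, z mod int m])" for xs
  proof
    assume xs: "xs \<in> D_tuples m 3"
    then obtain x y z where "xs = [x mod int m, y mod int m, z mod int m]"
      using D_tuples_subset[of m 3] unfolding YB_tuples_3 by blast
    with xs iff[of x y z] show "(\<exists>y z. xs = [(y + 1) mod int m, y mod int m, z mod int m]) \<or>
      (\<exists>x z. xs = [x mod int m, (z + 1) mod int m, z mod int m])" by metis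
  qed (use iff in \<open>auto simp: mod_simps\<close>)
  then show ?thesis by blast
qed

lemma keys_e1 [simp]: "keys (e1 x) \<subseteq> YB_tuples m 1"
  unfolding e1_def YB_tuples_1 by auto

lemma keys_e2 [simp]: "keys (e2 x y) \<subseteq> YB_tuples m 2"
  unfolding e2_def YB_tuples_2 by auto

lemma keys_e3 [simp]: "keys (e3 x y z) \<subseteq> YB_tuples m 3"
  unfolding e3_def YB_tuples_3 by auto

lemma chain1_induct [consumes 1, case_names zero one diff]:
  assumes "keys c \<subseteq> YB_tuples m 1" "P 0" "\<And>x. P (e1 x)" "\<And>a b. P a \<Longrightarrow> P b \<Longrightarrow> P (a - b)"
  shows "P c"
  using assms(1) by (induction c rule: frag_induction) (use assms(2-) in \<open>auto simp: YB_tuples_1 e1_def\<close>)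

lemma chain2_induct [consumes 1, case_names zero one diff]:
  assumes "keys c \<subseteq> YB_tuples m 2" "P 0" "\<And>x y. P (e2 x y)" "\<And>a b. P a \<Longrightarrow> P b \<Longrightarrow> P (a - b)"
  shows "P c"
  using assms(1) by (induction c rule: frag_induction) (use assms(2-) in \<open>auto simp: YB_tuples_2 e2_def\<close>)

lemma chain3_induct [consumes 1, case_names zero one diff]:
  assumes "keys c \<subseteq> YB_tuples m 3" "P 0" "\<And>x y z. P (e3 x y z)" "\<And>a b. P a \<Longrightarrow> P b \<Longrightarrow> P (a - b)"
  shows "P c"
  using assms(1) by (induction c rule: frag_induction) (use assms(2-) in \<open>auto simp: YB_tuples_3 e3_def\<close>)

lemma D_chain2_induct [consumes 1, case_names zero one diff]:
  assumes "keys c \<subseteq> D_tuples m 2" "P 0" "\<And>y. P (e2 (y + 1) y)" "\<And>a b. P a \<Longrightarrow> P b \<Longrightarrow> P (a - b)"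
  shows "P c"
  using assms(1) by (induction c rule: frag_induction) (use assms(2-) in \<open>auto simp: D_tuples_2 e2_def\<close>)

lemma D_chain3_induct [consumes 1, case_names zero left right diff]:
  assumes "keys c \<subseteq> D_tuples m 3" "P 0" "\<And>y z. P (e3 (y + 1) y z)" "\<And>x z. P (e3 x (z + 1) z)"
    "\<And>a b. P a \<Longrightarrow> P b \<Longrightarrow> P (a - b)"
  shows "P c"
  using assms(1) by (induction c rule: frag_induction) (use assms(2-) in \<open>auto simp: D_tuples_3 e3_def\<close>)

lemma YB_boundary_1: "YB_boundary m 1 c = 0"
  by (simp add: YB_boundary_def)

lemma YB_boundary_e2: "YB_boundary m 2 (e2 x y) = e1 y - e1 (y + 1) - e1 (x - 1) + e1 x"
  by (simp add: YB_boundary_def e2_def e1_def face_l_def face_r_def numeral_2_eq_2 mod_simps)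

lemma YB_boundary_e3: "YB_boundary m 3 (e3 x y z) = g y z - g (x - 1) z + g (x - 1) (y - 1)"
  by (simp add: YB_boundary_def e3_def e2_def g_def face_l_def face_r_def numeral_3_eq_3 mod_simps
     algebra_simps)

abbreviation aug :: "(int list \<Rightarrow>\<^sub>0 int) \<Rightarrow> int" where
  "aug \<equiv> weighted_sum (\<lambda>_. 1)"

lemma aug_e [simp]: "aug (e1 x) = 1" "aug (e2 x y) = 1" "aug (g x y) = 0"
  by (simp_all add: e1_def e2_def g_def weighted_sum_simps)

text \<open>The entries are representatives in \<open>0, ..., m - 1\<close>, so this is an integer
  that depends on their choice; only its residue modulo \<open>m\<close> is invariant under adding
  boundaries.\<close>

abbreviation first_sum :: "(int list \<Rightarrow>\<^sub>0 int) \<Rightarrow> int" where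
  "first_sum \<equiv> weighted_sum hd"

lemma first_sum_e1 [simp]: "first_sum (e1 x) = x mod int m"
  by (simp add: e1_def)

abbreviation boundaries :: "int \<Rightarrow> (int list \<Rightarrow>\<^sub>0 int) set" where
  "boundaries n \<equiv> YB_boundary m n ` {c. keys c \<subseteq> YB_tuples m n}"

lemma boundaries_0 [simp]: "0 \<in> boundaries n"
  by (rule image_eqI[of _ _ 0]) auto

lemma boundaries_diff: "x \<in> boundaries n \<Longrightarrow> y \<in> boundaries n \<Longrightarrow> x - y \<in> boundaries n"
  by (force simp: keys_diff_subset simp flip: YB_boundary_diff)

lemma boundaries_add: "x \<in> boundaries n \<Longrightarrow> y \<in> boundaries n \<Longrightarrow> x + y \<in> boundaries n"
  by (force simp: keys_add_subset simp flip: YB_boundary_add)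

lemma boundaries_cmul: "x \<in> boundaries n \<Longrightarrow> frag_cmul k x \<in> boundaries n"
  by (force simp: keys_cmul_subset simp flip: YB_boundary_cmul)

subsection \<open>Degree one\<close>

text \<open>Here \<open>k\<close> is any natural number, not just a residue: for
  \<open>k = m\<close> the first two terms cancel, which leaves the relation that makes the class of
  \<open>e1 0 - e1 1\<close> torsion.\<close>

lemma e1_reduction: "e1 (int k) - e1 0 + frag_cmul (int k) (e1 0 - e1 1) \<in> boundaries 2"
proof (induction k)
  case (Suc k)
  \<comment> \<open>The boundary of \<open>(k + 1, 0)\<close> is the difference
    \<open>e1 0 - e1 1\<close> minus the difference \<open>e1 k - e1 (k + 1)\<close>, so adding it
    advances the telescoping sum by one step.\<close>
  have "e1 (int (Suc k)) - e1 0 + frag_cmul (int (Suc k)) (e1 0 - e1 1)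
      = e1 (int k) - e1 0 + frag_cmul (int k) (e1 0 - e1 1) + YB_boundary m 2 (e2 (int (Suc k)) 0)"
    by (simp add: YB_boundary_e2 frag_cmul_distrib add.commute)
  moreover have "YB_boundary m 2 (e2 (int (Suc k)) 0) \<in> boundaries 2"
    by (intro imageI) simp
  ultimately show ?case using boundaries_add[OF Suc] by metis
qed simp

text \<open>A normal form with respect to two generators of the first homology: \<open>e1 0\<close>
  for the summand Z and \<open>e1 0 - e1 1\<close> for the torsion summand.\<close>

lemma chain1_reduction:
  assumes "keys c \<subseteq> YB_tuples m 1"
  shows "c - frag_cmul (aug c) (e1 0) + frag_cmul (first_sum c) (e1 0 - e1 1) \<in> boundaries 2"
  using assms
proof (induction c rule: chain1_induct)
  case (one x)
  show ?case using e1_reduction[of "nat (x mod int m)"] mod_in_range[of x] by simp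
next
  case (diff a b)
  from boundaries_diff[OF this] show ?case
    by (simp add: weighted_sum_simps frag_cmul_diff_distrib algebra_simps)
qed simp

lemma weighted_sums_of_boundary_2:
  assumes "keys c \<subseteq> YB_tuples m 2"
  shows "aug (YB_boundary m 2 c) = 0" "int m dvd first_sum (YB_boundary m 2 c)"
  using assms
proof (induction c rule: chain2_induct)
  case (one x y)
  { case 1 then show ?case by (simp add: YB_boundary_e2 weighted_sum_simps) }
  { case 2
    \<comment> \<open>Without reduction the four entries cancel, y - (y + 1) - (x - 1) + x = 0; what
      remains are the multiples of \<open>m\<close> removed by \<open>mod\<close>.\<close>
    have "first_sum (YB_boundary m 2 (e2 x y))
        = int m * ((y + 1) div int m + (x - 1) div int m - y div int m - x div int m)"
      by (simp add: YB_boundary_e2 weighted_sum_simps minus_mult_div_eq_mod[symmetric] algebra_simps)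
    then show ?case by simp }
qed (simp_all add: YB_boundary_diff weighted_sum_simps)

lemma boundaries_2_iff:
  assumes "keys c \<subseteq> YB_tuples m 1"
  shows "c \<in> boundaries 2 \<longleftrightarrow> aug c = 0 \<and> int m dvd first_sum c"
proof
  assume "aug c = 0 \<and> int m dvd first_sum c"
  then obtain k where k: "aug c = 0" "first_sum c = k * int m"
    by (auto simp: dvd_def mult.commute)
  have "e1 (int m) = e1 0" by (simp add: e1_def)
  then have "frag_cmul (int m) (e1 0 - e1 1) \<in> boundaries 2"
    using e1_reduction[of m] by simp
  from boundaries_cmul[OF this, of k] have "frag_cmul (first_sum c) (e1 0 - e1 1) \<in> boundaries 2"
    by (simp add: k)
  from boundaries_diff[OF chain1_reduction[OF assms] this] show "c \<in> boundaries 2"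
    by (simp add: k)
qed (auto simp: weighted_sums_of_boundary_2)

definition phi1 :: "(int list \<Rightarrow>\<^sub>0 int) \<Rightarrow> int \<times> int" where
  "phi1 c = (aug c, first_sum c mod int m)"

lemma phi1_add: "phi1 (x + y) = phi1 x \<otimes>\<^bsub>integer_group \<times>\<times> integer_mod_group m\<^esub> phi1 y"
  by (simp add: phi1_def weighted_sum_simps mod_simps)

lemma phi1_onto:
  "phi1 ` {c. keys c \<subseteq> YB_tuples m 1} = carrier (integer_group \<times>\<times> integer_mod_group m)"
proof
  show "carrier (integer_group \<times>\<times> integer_mod_group m) \<subseteq> phi1 ` {c. keys c \<subseteq> YB_tuples m 1}"
  proof
    fix p assume "p \<in> carrier (integer_group \<times>\<times> integer_mod_group m)"
    then obtain u v where p: "p = (u, v)" "0 \<le> v" "v < int m"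
      using m_pos by (cases p) (auto simp: carrier_integer_mod_group)
    \<comment> \<open>The \<open>v\<close> copies of \<open>e1 1\<close> provide the residue, and
      the copies of \<open>e1 0\<close>, which have entry 0, correct the coefficient sum to
      \<open>u\<close>.\<close>
    let ?c = "frag_cmul v (e1 1) + frag_cmul (u - v) (e1 0)"
    have "phi1 ?c = p"
      using p by (simp add: phi1_def weighted_sum_simps mod_simps)
    moreover have "keys ?c \<subseteq> YB_tuples m 1"
      by (intro keys_subset_intros keys_e1)
    ultimately show "p \<in> phi1 ` {c. keys c \<subseteq> YB_tuples m 1}" by blast
  qed
qed (use m_pos in \<open>auto simp: phi1_def carrier_integer_mod_group\<close>)

lemma phi1_eq_one_iff:
  assumes "keys c \<subseteq> YB_tuples m 1"
  shows "phi1 c = \<one>\<^bsub>integer_group \<times>\<times> integer_mod_group m\<^esub> \<longleftrightarrow> c \<in> boundaries 2"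
  using boundaries_2_iff[OF assms] by (auto simp: phi1_def dvd_eq_mod_eq_0)

lemma group_H1: "group (integer_group \<times>\<times> integer_mod_group m)"
  by (simp add: DirProd_group)

theorem H_YB_1: "H_YB 1 m \<cong> integer_group \<times>\<times> integer_mod_group m"
proof (rule H_YB_iso[where \<phi> = phi1, OF m_pos group_H1])
  show "phi1 ` {x. keys x \<subseteq> YB_tuples m 1 \<and> YB_boundary m 1 x = 0}
      = carrier (integer_group \<times>\<times> integer_mod_group m)"
    using phi1_onto by (simp add: YB_boundary_1)
  show "phi1 x = \<one>\<^bsub>integer_group \<times>\<times> integer_mod_group m\<^esub> \<longleftrightarrow>
      (\<exists>e. keys e \<subseteq> YB_tuples m (1 + 1) \<and> x = YB_boundary m (1 + 1) e)"
    if "keys x \<subseteq> YB_tuples m 1" for x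
    using phi1_eq_one_iff[OF that] by auto
qed (rule phi1_add YB_boundary_1)+

text \<open>For \<open>(y + 1, y)\<close> the four terms of the boundary cancel in pairs. Thus every
  degenerate 2-chain is a cycle, and the quotient changes nothing in degree one.\<close>

lemma YB_boundary_2_D:
  assumes "keys c \<subseteq> D_tuples m 2"
  shows "YB_boundary m 2 c = 0"
  using assms
  by (induction c rule: D_chain2_induct) (simp_all add: YB_boundary_e2 YB_boundary_diff)

theorem H_NYB_1: "H_NYB 1 m \<cong> integer_group \<times>\<times> integer_mod_group m"
proof (rule H_NYB_iso[where \<phi> = phi1, OF m_pos group_H1])
  show "phi1 ` {x. keys x \<subseteq> YB_tuples m 1 \<and> keys (YB_boundary m 1 x) \<subseteq> D_tuples m (1 - 1)}
      = carrier (integer_group \<times>\<times> integer_mod_group m)"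
    using phi1_onto by (simp add: YB_boundary_1)
  show "phi1 x = \<one>\<^bsub>integer_group \<times>\<times> integer_mod_group m\<^esub> \<longleftrightarrow>
      (\<exists>e. keys e \<subseteq> YB_tuples m (1 + 1) \<and> keys (x - YB_boundary m (1 + 1) e) \<subseteq> D_tuples m 1)"
    if "keys x \<subseteq> YB_tuples m 1" for x
    using phi1_eq_one_iff[OF that] by (auto simp: D_tuples_1)
  show "phi1 (x + y) = phi1 x \<otimes>\<^bsub>integer_group \<times>\<times> integer_mod_group m\<^esub> phi1 y" for x y
    by (rule phi1_add)
qed (simp_all add: YB_boundary_1 YB_boundary_2_D)

theorem H_D_1: "trivial_group (H_D 1 m)"
proof -
  \<comment> \<open>The integers modulo 1 serve as a concrete trivial group to which the isomorphism
    criterion can be applied.\<close>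
  let ?T = "integer_mod_group 1"
  have 1: "(\<lambda>_. 0) ` {x. keys x \<subseteq> D_tuples m 1 \<and> YB_boundary m 1 x = 0} = carrier ?T"
    by (auto simp: D_tuples_1 carrier_integer_mod_group)
  have 2: "\<exists>e. keys e \<subseteq> D_tuples m (1 + 1) \<and> x = YB_boundary m (1 + 1) e"
    if "keys x \<subseteq> D_tuples m 1" for x
    by (rule exI[of _ 0]) (use that in \<open>simp add: D_tuples_1\<close>)
  note iso = H_D_iso[where n = 1 and m = m and H = ?T and \<phi> = "\<lambda>_. 0"]
  have "H_D 1 m \<cong> ?T"
    by (rule iso(1)) (use 1 2 in \<open>auto simp: YB_boundary_1 YB_boundary_2_D\<close>)
  moreover have "group (H_D 1 m)"
    by (rule iso(2)) (use 1 2 in \<open>auto simp: YB_boundary_1 YB_boundary_2_D\<close>)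
  ultimately show ?thesis
    by (simp add: isomorphic_group_triviality[where H = ?T] trivial_integer_mod_group)
qed

subsection \<open>Cycles of degree two\<close>

text \<open>Since \<open>\<partial>\<^sub>2 (x, y) = \<Delta> (y + 1) - \<Delta> x\<close> for \<open>\<Delta> x = (x - 1) - x\<close>, and \<open>\<Delta>\<close> is injective on chains of
  coefficient sum zero, the cycles of degree two are exactly the kernel of \<open>end_diff\<close>.\<close>

definition end_diff :: "(int list \<Rightarrow>\<^sub>0 int) \<Rightarrow> (int list \<Rightarrow>\<^sub>0 int)" where
  "end_diff = frag_extend (\<lambda>xs. e1 (xs ! 1 + 1) - e1 (xs ! 0))"

definition shift :: "(int list \<Rightarrow>\<^sub>0 int) \<Rightarrow> (int list \<Rightarrow>\<^sub>0 int)" where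
  "shift = frag_extend (\<lambda>xs. e1 (xs ! 0 + 1))"

lemma end_diff_e2 [simp]: "end_diff (e2 x y) = e1 (y + 1) - e1 x"
  by (simp add: end_diff_def e2_def)

lemma end_diff_0 [simp]: "end_diff 0 = 0"
  by (simp add: end_diff_def)

lemma end_diff_simps:
  "end_diff (a - b) = end_diff a - end_diff b" "end_diff (a + b) = end_diff a + end_diff b"
  "end_diff (frag_cmul k a) = frag_cmul k (end_diff a)"
  by (simp_all add: end_diff_def frag_extend_simps)

lemma end_diff_sum: "end_diff (sum f I) = (\<Sum>i\<in>I. end_diff (f i))"
  by (induction I rule: infinite_finite_induct) (simp_all add: end_diff_simps)

lemma end_diff_g: "end_diff (g x y) = (e1 (y + 1) - e1 (y + 2)) - (e1 x - e1 (x + 1))"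
  by (simp add: g_def end_diff_simps add.assoc)

lemma shift_e1 [simp]: "shift (e1 x) = e1 (x + 1)"
  by (simp add: shift_def e1_def mod_simps)

lemma shift_0 [simp]: "shift 0 = 0"
  by (simp add: shift_def)

lemma shift_diff: "shift (a - b) = shift a - shift b"
  by (simp add: shift_def frag_extend_simps)

lemma keys_end_diff:
  assumes "keys c \<subseteq> YB_tuples m 2"
  shows "keys (end_diff c) \<subseteq> YB_tuples m 1"
  using assms
  by (induction c rule: chain2_induct) (simp_all add: end_diff_simps keys_diff_subset)

lemma aug_end_diff:
  assumes "keys c \<subseteq> YB_tuples m 2"
  shows "aug (end_diff c) = 0"
  using assms
  by (induction c rule: chain2_induct) (simp_all add: end_diff_simps weighted_sum_simps)

lemma lookup_shift:
  assumes "keys p \<subseteq> YB_tuples m 1"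
  shows "Poly_Mapping.lookup (shift p) [(x + 1) mod int m] = Poly_Mapping.lookup p [x mod int m]"
  using assms
proof (induction p rule: chain1_induct)
  case (one y)
  have "(x + 1) mod int m = (y + 1) mod int m \<longleftrightarrow> x mod int m = y mod int m"
    using mod_add_cong[of x "int m" y 1 1] mod_diff_cong[of "x + 1" "int m" "y + 1" 1 1] by auto
  then show ?case unfolding shift_e1 by (simp add: e1_def)
qed (simp_all add: shift_diff lookup_minus)

lemma aug_eq_sum:
  assumes "keys p \<subseteq> YB_tuples m 1"
  shows "aug p = (\<Sum>k<m. Poly_Mapping.lookup p [int k])"
  using assms
proof (induction p rule: chain1_induct)
  case (one x)
  have "(\<Sum>k<m. Poly_Mapping.lookup (e1 x) [int k])
      = (\<Sum>k<m. if k = nat (x mod int m) then 1 else 0)"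
    using mod_in_range[of x] by (intro sum.cong) (auto simp: e1_def)
  also have "\<dots> = 1"
    using mod_in_range[of x] by (simp add: nat_less_iff)
  finally show ?case by simp
qed (simp_all add: weighted_sum_simps lookup_minus sum_subtractf)

text \<open>The shift permutes the basis in a single orbit, so an invariant chain has constant
  coefficients and its coefficient sum is \<open>m\<close> times that constant. This handles both
  the cycle condition and the final step of the reduction of 2-chains.\<close>

lemma shift_fixed_eq_0:
  assumes p: "keys p \<subseteq> YB_tuples m 1" and "shift p = p" and "aug p = 0"
  shows "p = 0"
proof -
  have const: "Poly_Mapping.lookup p [int k mod int m] = Poly_Mapping.lookup p [0]" for k
  proof (induction k)
    case (Suc k)
    then show ?case using lookup_shift[OF p, of "int k"] assms(2) by (simp add: add.commute)
  qed simp
  have "Poly_Mapping.lookup p [int k] = Poly_Mapping.lookup p [0]" if "k < m" for k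
    using const[of k] that by simp
  then have "aug p = int m * Poly_Mapping.lookup p [0]"
    by (simp add: aug_eq_sum[OF p])
  then have zero: "Poly_Mapping.lookup p [0] = 0"
    using assms(3) m_pos by simp
  have "Poly_Mapping.lookup p xs = 0" for xs
  proof (cases "xs \<in> YB_tuples m 1")
    case True
    then obtain x where "xs = [x mod int m]" unfolding YB_tuples_1 by blast
    with const[of "nat (x mod int m)"] zero mod_in_range[of x] show ?thesis by simp
  next
    case False
    with p show ?thesis by (auto simp: in_keys_iff)
  qed
  then show ?thesis by (intro poly_mapping_eqI) simp
qed

text \<open>Shifting turns the entries y and x - 1 of the boundary into the endpoints y + 1 and x,
  so that vanishing of the boundary becomes shift invariance of \<open>end_diff c\<close>.\<close>

lemma shift_YB_boundary_2:
  assumes "keys c \<subseteq> YB_tuples m 2"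
  shows "shift (YB_boundary m 2 c) = end_diff c - shift (end_diff c)"
  using assms
proof (induction c rule: chain2_induct)
  case (one x y)
  have "shift (a + b) = shift a + shift b" for a b
    by (simp add: shift_def frag_extend_simps)
  then show ?case by (simp add: YB_boundary_e2 shift_diff)
qed (simp_all add: YB_boundary_diff shift_diff end_diff_simps)

lemma YB_boundary_2_eq:
  assumes "keys c \<subseteq> YB_tuples m 2"
  shows "YB_boundary m 2 c = frag_extend (\<lambda>xs. e1 (xs ! 0 - 1) - e1 (xs ! 0)) (end_diff c)"
  using assms
proof (induction c rule: chain2_induct)
  case (one x y)
  have "frag_extend (\<lambda>xs. e1 (xs ! 0 - 1) - e1 (xs ! 0)) (e1 z) = e1 (z - 1) - e1 z" for z
    by (simp add: e1_def mod_simps)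
  then show ?case by (simp add: YB_boundary_e2 frag_extend_simps)
qed (simp_all add: YB_boundary_diff frag_extend_simps end_diff_simps)

lemma cycle_2_iff:
  assumes "keys c \<subseteq> YB_tuples m 2"
  shows "YB_boundary m 2 c = 0 \<longleftrightarrow> end_diff c = 0"
proof
  assume "YB_boundary m 2 c = 0"
  then have "shift (end_diff c) = end_diff c"
    using shift_YB_boundary_2[OF assms] by simp
  then show "end_diff c = 0"
    by (intro shift_fixed_eq_0 keys_end_diff aug_end_diff assms)
qed (simp add: YB_boundary_2_eq[OF assms])

text \<open>With f x = \<open>e1 x - e1 (x + 1)\<close>, \<open>end_diff\<close> sends
  \<open>g x y\<close> to f (y + 1) - f x; these differences cancel over the three terms of the
  boundary of a triple.\<close>

lemma end_diff_boundary:
  assumes "keys c \<subseteq> YB_tuples m 3"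
  shows "end_diff (YB_boundary m 3 c) = 0"
  using assms
  by (induction c rule: chain3_induct)
    (simp_all add: YB_boundary_diff YB_boundary_e3 end_diff_simps end_diff_g add.commute)

lemma keys_YB_boundary_3:
  "keys c \<subseteq> YB_tuples m 3 \<Longrightarrow> keys (YB_boundary m 3 c) \<subseteq> YB_tuples m 2"
  using keys_YB_boundary[of c m 3] m_pos by simp

lemma YB_boundary_2_3:
  assumes "keys c \<subseteq> YB_tuples m 3"
  shows "YB_boundary m 2 (YB_boundary m 3 c) = 0"
  using assms by (simp add: cycle_2_iff keys_YB_boundary_3 end_diff_boundary)

subsection \<open>Diagonal counts\<close>

text \<open>The diagonal of \<open>(x, y)\<close> is numbered by \<open>y - x + 1\<close> modulo \<open>m\<close>, so that the degenerate pairs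
  form diagonal \<open>0\<close>.\<close>

definition diag :: "int list \<Rightarrow> int" where
  "diag xs = (xs ! 1 - xs ! 0 + 1) mod int m"

definition diag_count :: "nat \<Rightarrow> (int list \<Rightarrow>\<^sub>0 int) \<Rightarrow> int" where
  "diag_count j = weighted_sum (\<lambda>xs. if diag xs = int j then 1 else 0)"

definition diag_sum :: "(int list \<Rightarrow>\<^sub>0 int) \<Rightarrow> int" where
  "diag_sum = weighted_sum diag"

lemma diag_simps:
  "diag_count j (a - b) = diag_count j a - diag_count j b"
  "diag_count j (a + b) = diag_count j a + diag_count j b"
  "diag_count j (frag_cmul k a) = k * diag_count j a"
  "diag_count j (sum f I) = (\<Sum>i\<in>I. diag_count j (f i))"
  "diag_sum (a - b) = diag_sum a - diag_sum b"
  "diag_sum (a + b) = diag_sum a + diag_sum b"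
  "diag_sum (frag_cmul k a) = k * diag_sum a"
  "diag_sum (sum f I) = (\<Sum>i\<in>I. diag_sum (f i))"
  by (simp_all add: diag_count_def diag_sum_def weighted_sum_simps)

lemma diag_0 [simp]: "diag_count j 0 = 0" "diag_sum 0 = 0"
  by (simp_all add: diag_count_def diag_sum_def)

lemma diag_pair: "diag [x mod int m, y mod int m] = (y - x + 1) mod int m"
proof -
  have "(y mod int m - x mod int m + 1) mod int m = (y - x + 1) mod int m"
    by (metis mod_add_left_eq mod_diff_eq)
  then show ?thesis by (simp add: diag_def)
qed

lemma diag_count_e2 [simp]:
  "diag_count j (e2 x y) = (if (y - x + 1) mod int m = int j then 1 else 0)"
  by (simp add: e2_def diag_count_def diag_pair)

lemma diag_sum_e2 [simp]: "diag_sum (e2 x y) = (y - x + 1) mod int m"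
  by (simp add: e2_def diag_sum_def diag_pair)

lemma diag_g [simp]: "diag_count j (g x y) = 0" "diag_sum (g x y) = 0"
  by (simp_all add: g_def diag_simps)

text \<open>Boundaries of triples are combinations of values of \<open>g\<close>, and
  \<open>g\<close> compares two pairs on the same diagonal.\<close>

lemma diag_boundary:
  assumes "keys c \<subseteq> YB_tuples m 3"
  shows "diag_count j (YB_boundary m 3 c) = 0" "diag_sum (YB_boundary m 3 c) = 0"
  using assms
  by (induction c rule: chain3_induct)
    (simp_all add: YB_boundary_diff YB_boundary_e3 diag_simps)

lemma sum_diag_delta:
  fixes f :: "nat \<Rightarrow> 'b :: comm_monoid_add"
  shows "(\<Sum>j<m. if x mod int m = int j then f j else 0) = f (nat (x mod int m))"
proof -
  have "(\<Sum>j<m. if x mod int m = int j then f j else 0)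
      = (\<Sum>j<m. if j = nat (x mod int m) then f j else 0)"
    using mod_in_range[of x] by (intro sum.cong) auto
  then show ?thesis
    using mod_in_range[of x] by (simp add: nat_less_iff)
qed

lemma diag_sum_eq:
  assumes "keys c \<subseteq> YB_tuples m 2"
  shows "diag_sum c = (\<Sum>j<m. int j * diag_count j c)"
  using assms
proof (induction c rule: chain2_induct)
  case (one x y)
  have "(\<Sum>j<m. int j * diag_count j (e2 x y))
      = (\<Sum>j<m. if (y - x + 1) mod int m = int j then int j else 0)"
    by (intro sum.cong) auto
  then show ?case
    using mod_in_range[of "y - x + 1"] by (simp add: sum_diag_delta)
qed (simp_all add: diag_simps sum_subtractf right_diff_distrib)

text \<open>The diagonal number y - x + 1 of \<open>(x, y)\<close> is its endpoint y + 1 minus its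
  starting point x, up to reductions modulo \<open>m\<close>. Since \<open>end_diff\<close> vanishes
  on cycles, this is the source of the congruence.\<close>

lemma dvd_diag_sum_diff:
  assumes "keys c \<subseteq> YB_tuples m 2"
  shows "int m dvd diag_sum c - first_sum (end_diff c)"
  using assms
proof (induction c rule: chain2_induct)
  case (one x y)
  have "diag_sum (e2 x y) - first_sum (end_diff (e2 x y))
      = int m * ((y + 1) div int m - x div int m - (y - x + 1) div int m)"
    by (simp add: weighted_sum_simps diag_simps minus_mult_div_eq_mod[symmetric] algebra_simps)
  then show ?case by simp
next
  case (diff a b)
  from dvd_diff[OF this] show ?case
    by (simp add: weighted_sum_simps diag_simps end_diff_simps algebra_simps)
qed simp

lemma dvd_diag_sum:
  assumes "keys c \<subseteq> YB_tuples m 2" "YB_boundary m 2 c = 0"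
  shows "int m dvd diag_sum c"
  using dvd_diag_sum_diff[OF assms(1)] assms by (simp add: cycle_2_iff)

section \<open>Reduction of 2-chains to their diagonal counts\<close>

text \<open>Modulo boundaries \<open>g\<close> is a cocycle, so that all its values are differences of the values
  \<open>g 0 x\<close>, which are spanned by the image of \<open>gbase\<close>.\<close>

definition gbase :: "(int list \<Rightarrow>\<^sub>0 int) \<Rightarrow> (int list \<Rightarrow>\<^sub>0 int)" where
  "gbase = frag_extend (\<lambda>xs. g 0 (xs ! 0 - 1))"

lemma gbase_e1 [simp]: "gbase (e1 x) = g 0 (x - 1)"
  by (simp add: gbase_def e1_def g_def e2_def mod_simps)

lemma gbase_0 [simp]: "gbase 0 = 0"
  by (simp add: gbase_def)

lemma gbase_diff: "gbase (a - b) = gbase a - gbase b"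
  by (simp add: gbase_def frag_extend_simps)

lemma gbase_add: "gbase (a + b) = gbase a + gbase b"
  by (simp add: gbase_def frag_extend_simps)

text \<open>If \<open>aug p = 0\<close>, then \<open>gbase p\<close> has vanishing
  \<open>end_diff\<close> only for shift-invariant \<open>p\<close>; this is how the leftover of the
  reduction is eliminated.\<close>

lemma end_diff_gbase:
  assumes "keys p \<subseteq> YB_tuples m 1"
  shows "end_diff (gbase p) = p - shift p - frag_cmul (aug p) (e1 0 - e1 1)"
  using assms
  by (induction p rule: chain1_induct)
    (simp_all add: end_diff_simps end_diff_g gbase_diff shift_diff weighted_sum_simps
      frag_cmul_diff_distrib add.commute)

text \<open>The pair is moved along its diagonal to first entry 0. Each step costs one value of
  \<open>g\<close>, which modulo boundaries is a difference of two values of \<open>gbase\<close>;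
  hence the coefficient sum of \<open>p\<close> stays 0.\<close>

lemma e2_reduction:
  "\<exists>p. keys p \<subseteq> YB_tuples m 1 \<and> aug p = 0 \<and>
     e2 (int k) y - e2 0 (y - int k) - gbase p \<in> boundaries 3"
proof (induction k arbitrary: y)
  case 0
  show ?case by (rule exI[of _ 0]) simp
next
  case (Suc k)
  then obtain p where p: "keys p \<subseteq> YB_tuples m 1" "aug p = 0"
    "e2 (int k) (y - 1) - e2 0 (y - 1 - int k) - gbase p \<in> boundaries 3" by blast
  \<comment> \<open>The step from \<open>(k, y - 1)\<close> to \<open>(k + 1, y)\<close> subtracts
    \<open>g k (y - 1)\<close>. The triple \<open>(1, k, y - 1)\<close>, whose first entry minus 1
    is 0, identifies this with \<open>g 0 (y - 1) - g 0 (k - 1)\<close>, the image of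
    \<open>e1 y - e1 k\<close> under \<open>gbase\<close>.\<close>
  let ?p = "p - (e1 y - e1 (int k))"
  have "YB_boundary m 3 (e3 1 (int k) (y - 1)) = g (int k) (y - 1) - g 0 (y - 1) + g 0 (int k - 1)"
    by (simp add: YB_boundary_e3)
  moreover have "YB_boundary m 3 (e3 1 (int k) (y - 1)) \<in> boundaries 3"
    by (intro imageI) simp
  ultimately have "g (int k) (y - 1) - g 0 (y - 1) + g 0 (int k - 1) \<in> boundaries 3" by simp
  from boundaries_diff[OF p(3) this]
  have "e2 (int (Suc k)) y - e2 0 (y - int (Suc k)) - gbase ?p \<in> boundaries 3"
    by (simp add: g_def gbase_diff gbase_add algebra_simps)
  moreover have "keys ?p \<subseteq> YB_tuples m 1" "aug ?p = 0"
    using p by (simp_all add: keys_diff_subset weighted_sum_simps)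
  ultimately show ?case by blast
qed

text \<open>The pair \<open>(0, j - 1)\<close> is the representative of diagonal \<open>j\<close>
  with first entry 0.\<close>

lemma chain2_reduction:
  assumes "keys c \<subseteq> YB_tuples m 2"
  shows "\<exists>p. keys p \<subseteq> YB_tuples m 1 \<and> aug p = 0 \<and>
     c - (\<Sum>j<m. frag_cmul (diag_count j c) (e2 0 (int j - 1))) - gbase p \<in> boundaries 3"
  using assms
proof (induction c rule: chain2_induct)
  case zero
  show ?case by (rule exI[of _ 0]) simp
next
  case (one x y)
  have "(\<Sum>j<m. frag_cmul (diag_count j (e2 x y)) (e2 0 (int j - 1)))
      = (\<Sum>j<m. if (y - x + 1) mod int m = int j then e2 0 (int j - 1) else 0)"
    by (intro sum.cong) auto
  also have "\<dots> = e2 0 ((y - x + 1) mod int m - 1)"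
    using mod_in_range[of "y - x + 1"] by (simp add: sum_diag_delta)
  also have "\<dots> = e2 0 (y - x mod int m)"
    by (simp add: e2_def mod_simps)
  finally show ?case
    using e2_reduction[of "nat (x mod int m)" y] mod_in_range[of x] by simp
next
  case (diff a b)
  then obtain p q where
    p: "keys p \<subseteq> YB_tuples m 1" "aug p = 0"
      "a - (\<Sum>j<m. frag_cmul (diag_count j a) (e2 0 (int j - 1))) - gbase p \<in> boundaries 3" and
    q: "keys q \<subseteq> YB_tuples m 1" "aug q = 0"
      "b - (\<Sum>j<m. frag_cmul (diag_count j b) (e2 0 (int j - 1))) - gbase q \<in> boundaries 3"
    by blast
  from boundaries_diff[OF p(3) q(3)]
  have "a - b - (\<Sum>j<m. frag_cmul (diag_count j (a - b)) (e2 0 (int j - 1))) - gbase (p - q)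
      \<in> boundaries 3"
    by (simp add: diag_simps frag_cmul_diff_distrib sum_subtractf gbase_diff algebra_simps)
  moreover have "keys (p - q) \<subseteq> YB_tuples m 1" "aug (p - q) = 0"
    using p q by (simp_all add: keys_diff_subset weighted_sum_simps)
  ultimately show ?case by blast
qed

text \<open>With all counts zero the reduction leaves only \<open>gbase p\<close>. Applying
  \<open>end_diff\<close> annihilates both the cycle and the boundary, so \<open>p\<close> is
  shift-invariant with sum zero, hence 0.\<close>

lemma boundaries_3I:
  assumes c: "keys c \<subseteq> YB_tuples m 2" "YB_boundary m 2 c = 0"
    and "\<And>j. j < m \<Longrightarrow> diag_count j c = 0"
  shows "c \<in> boundaries 3"
proof -
  obtain p where p: "keys p \<subseteq> YB_tuples m 1" "aug p = 0" "c - gbase p \<in> boundaries 3"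
    using chain2_reduction[OF c(1)] assms(3) by auto
  then obtain e where e: "keys e \<subseteq> YB_tuples m 3" "c - gbase p = YB_boundary m 3 e" by blast
  then have "c = gbase p + YB_boundary m 3 e" by (simp add: algebra_simps)
  then have "end_diff c = p - shift p"
    using p e by (simp add: end_diff_simps end_diff_boundary end_diff_gbase)
  then have "shift p = p" using c by (simp add: cycle_2_iff)
  then have "p = 0" using p by (intro shift_fixed_eq_0)
  with p show ?thesis by simp
qed

text \<open>The diagonal counts of a cycle satisfy one congruence modulo \<open>m\<close>; replacing the count of
  diagonal \<open>1\<close> by the quotient in this congruence leaves the remaining coordinates unconstrained.\<close>

definition coord :: "nat \<Rightarrow> (int list \<Rightarrow>\<^sub>0 int) \<Rightarrow> int" where
  "coord j c = (if j = 1 then diag_sum c div int m else diag_count j c)"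

lemma coord_add:
  assumes "keys x \<subseteq> YB_tuples m 2" "YB_boundary m 2 x = 0"
    and "keys y \<subseteq> YB_tuples m 2" "YB_boundary m 2 y = 0"
  shows "coord j (x + y) = coord j x + coord j y"
  using dvd_diag_sum[OF assms(1,2)] by (simp add: coord_def diag_simps div_plus_div_distrib_dvd_left)

lemma coord_boundary:
  assumes "keys e \<subseteq> YB_tuples m 3"
  shows "coord j (YB_boundary m 3 e) = 0"
  using assms by (simp add: coord_def diag_boundary)

text \<open>Divisibility turns a zero quotient into \<open>diag_sum c = 0\<close>; as the other
  counts vanish or have weight 0, this sum is the count of diagonal \<open>1\<close>.\<close>

lemma cycle_in_boundaries_3I:
  assumes c: "keys c \<subseteq> YB_tuples m 2" "YB_boundary m 2 c = 0"
    and zero: "\<And>j. j < m \<Longrightarrow> coord j c = 0"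
  shows "c \<in> boundaries 3"
proof (rule boundaries_3I[OF c])
  have other: "diag_count j c = 0" if "j < m" "j \<noteq> 1" for j
    using zero[OF that(1)] that(2) by (simp add: coord_def)
  fix j assume j: "j < m"
  show "diag_count j c = 0"
  proof (cases "j = 1")
    case True
    with j have "diag_sum c = 0"
      using zero[of 1] dvd_diag_sum[OF c] by (simp add: coord_def dvd_div_eq_0_iff)
    moreover have "diag_sum c = (\<Sum>k<m. if k = 1 then diag_count 1 c else 0)"
      unfolding diag_sum_eq[OF c(1)] by (intro sum.cong) (auto simp: other)
    ultimately show ?thesis using True j by simp
  qed (use other j in simp)
qed

text \<open>The cycles dual to \<open>coord\<close>. In the edge picture \<open>(k, k)\<close> is a
  unit edge from k to k + 1. For \<open>j = 1\<close> the \<open>m\<close> unit edges form the full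
  loop, with total length \<open>m\<close> and quotient 1. Otherwise the edge
  \<open>(0, j - 1)\<close> of length \<open>j\<close> is closed up by the unit edges from 0 to
  \<open>j\<close> traversed backwards, so the total length is 0; \<open>j = 0\<close> gives a
  degenerate pair.\<close>

definition basic_cycle :: "nat \<Rightarrow> (int list \<Rightarrow>\<^sub>0 int)" where
  "basic_cycle j = (if j = 1 then (\<Sum>k<m. e2 (int k) (int k))
     else e2 0 (int j - 1) - (\<Sum>k<j. e2 (int k) (int k)))"

lemma keys_basic_cycle: "keys (basic_cycle j) \<subseteq> YB_tuples m 2"
  unfolding basic_cycle_def by (cases "j = 1") (simp_all add: keys_diff_subset keys_sum_subset)

lemma end_diff_diagonal: "end_diff (\<Sum>k<j. e2 (int k) (int k)) = e1 (int j) - e1 0"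
  by (induction j) (simp_all add: end_diff_simps add.commute)

lemma end_diff_basic_cycle: "end_diff (basic_cycle j) = 0"
proof -
  have "e1 (int m) = e1 0" by (simp add: e1_def)
  then show ?thesis by (simp add: basic_cycle_def end_diff_simps end_diff_diagonal)
qed

lemma coord_basic_cycle:
  assumes "i < m" "j < m"
  shows "coord i (basic_cycle j) = (if i = j then 1 else 0)"
\<comment> \<open>For \<open>m = 1\<close> the pairs \<open>(k, k)\<close> lie on diagonal
  \<open>0\<close> instead of \<open>1\<close>, and only the index 0 occurs.\<close>
proof (cases "m = 1")
  case True
  with assms have "i = 0" "j = 0" by simp_all
  then show ?thesis by (simp add: coord_def basic_cycle_def)
next
  case False
  with m_pos have "1 mod int m = 1" by simp
  then show ?thesis using assms m_pos
    by (auto simp: coord_def basic_cycle_def diag_simps)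
qed

definition cycle_of :: "(nat \<Rightarrow> int) \<Rightarrow> (int list \<Rightarrow>\<^sub>0 int)" where
  "cycle_of v = (\<Sum>j<m. frag_cmul (v j) (basic_cycle j))"

lemma cycle_of:
  "keys (cycle_of v) \<subseteq> YB_tuples m 2" "YB_boundary m 2 (cycle_of v) = 0"
proof -
  show k: "keys (cycle_of v) \<subseteq> YB_tuples m 2"
    unfolding cycle_of_def by (intro keys_subset_intros keys_basic_cycle)
  show "YB_boundary m 2 (cycle_of v) = 0"
    unfolding cycle_2_iff[OF k]
    by (simp add: cycle_of_def end_diff_sum end_diff_simps end_diff_basic_cycle)
qed

lemma coord_cycle_of:
  assumes "i < m"
  shows "coord i (cycle_of v) = v i"
proof -
  have cyc: "keys (frag_cmul k (basic_cycle j)) \<subseteq> YB_tuples m 2"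
      "YB_boundary m 2 (frag_cmul k (basic_cycle j)) = 0" for k j
    using keys_basic_cycle
    by (simp_all add: keys_cmul_subset YB_boundary_cmul cycle_2_iff end_diff_basic_cycle)
  have cmul: "coord i (frag_cmul k (basic_cycle j)) = k * coord i (basic_cycle j)" for k j
    using dvd_diag_sum[OF keys_basic_cycle[of j]] keys_basic_cycle[of j]
    by (simp add: coord_def diag_simps cycle_2_iff end_diff_basic_cycle div_mult_swap)
  \<comment> \<open>Because of the division, \<open>coord\<close> is additive only where
    divisibility is known; the induction therefore carries along that every partial sum is a
    cycle.\<close>
  define S where "S n = (\<Sum>j<n. frag_cmul (v j) (basic_cycle j))" for n
  have "keys (S n) \<subseteq> YB_tuples m 2 \<and> YB_boundary m 2 (S n) = 0 \<and>
      coord i (S n) = (\<Sum>j<n. v j * coord i (basic_cycle j))" for n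
  proof (induction n)
    case 0
    show ?case by (simp add: S_def coord_def)
  next
    case (Suc n)
    have "S (Suc n) = S n + frag_cmul (v n) (basic_cycle n)" by (simp add: S_def)
    with Suc show ?case
      by (simp add: keys_add_subset cyc YB_boundary_add coord_add cmul)
  qed
  then have "coord i (cycle_of v) = (\<Sum>j<m. v j * coord i (basic_cycle j))"
    by (simp add: S_def cycle_of_def)
  also have "\<dots> = (\<Sum>j<m. if i = j then v j else 0)"
    using assms by (intro sum.cong) (auto simp: coord_basic_cycle)
  finally show ?thesis using assms by simp
qed

subsection \<open>Degree two\<close>

theorem H_YB_2: "H_YB 2 m \<cong> integer_power_group m"
proof (rule H_YB_iso[where \<phi> = "\<lambda>c. \<lambda>j\<in>{..<m}. coord j c", OF m_pos])
  show "group (integer_power_group m)" by simp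
  show "(\<lambda>j\<in>{..<m}. coord j (x + y))
      = (\<lambda>j\<in>{..<m}. coord j x) \<otimes>\<^bsub>integer_power_group m\<^esub> (\<lambda>j\<in>{..<m}. coord j y)"
    if "keys x \<subseteq> YB_tuples m 2" "YB_boundary m 2 x = 0"
      "keys y \<subseteq> YB_tuples m 2" "YB_boundary m 2 y = 0" for x y
    using that by (simp add: coord_add fun_eq_iff)
  show "(\<lambda>c. \<lambda>j\<in>{..<m}. coord j c) ` {x. keys x \<subseteq> YB_tuples m 2 \<and> YB_boundary m 2 x = 0}
      = carrier (integer_power_group m)"
  proof
    show "carrier (integer_power_group m)
      \<subseteq> (\<lambda>c. \<lambda>j\<in>{..<m}. coord j c) ` {x. keys x \<subseteq> YB_tuples m 2 \<and> YB_boundary m 2 x = 0}"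
    proof
      fix v :: "nat \<Rightarrow> int" assume "v \<in> carrier (integer_power_group m)"
      then have "v \<in> extensional {..<m}" by (simp add: PiE_def)
      then have "v = (\<lambda>j\<in>{..<m}. coord j (cycle_of v))"
        by (intro extensionalityI[of _ "{..<m}"]) (simp_all add: coord_cycle_of)
      then show "v \<in> (\<lambda>c. \<lambda>j\<in>{..<m}. coord j c)
          ` {x. keys x \<subseteq> YB_tuples m 2 \<and> YB_boundary m 2 x = 0}"
        using cycle_of by (intro image_eqI[of _ _ "cycle_of v"]) auto
    qed
  qed (intro image_subsetI, simp add: restrict_PiE_iff)
  show "YB_boundary m 2 (YB_boundary m (2 + 1) e) = 0" if "keys e \<subseteq> YB_tuples m (2 + 1)" for e
    using that by (simp add: YB_boundary_2_3)
  show "(\<lambda>j\<in>{..<m}. coord j x) = \<one>\<^bsub>integer_power_group m\<^esub> \<longleftrightarrow>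
      (\<exists>e. keys e \<subseteq> YB_tuples m (2 + 1) \<and> x = YB_boundary m (2 + 1) e)"
    if x: "keys x \<subseteq> YB_tuples m 2" "YB_boundary m 2 x = 0" for x
  proof
    assume eq: "(\<lambda>j\<in>{..<m}. coord j x) = \<one>\<^bsub>integer_power_group m\<^esub>"
    have "coord j x = 0" if "j < m" for j
      using fun_cong[OF eq, of j] that by simp
    from cycle_in_boundaries_3I[OF x this]
    show "\<exists>e. keys e \<subseteq> YB_tuples m (2 + 1) \<and> x = YB_boundary m (2 + 1) e" by auto
  qed (auto simp: coord_boundary)
qed

section \<open>The degenerate complex in degree two\<close>

lemma keys_e2_D: "keys (e2 (y + 1) y) \<subseteq> D_tuples m 2"
  unfolding e2_def D_tuples_2 by auto

lemma keys_e3_D: "keys (e3 x (z + 1) z) \<subseteq> D_tuples m 3"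
  unfolding e3_def D_tuples_3 by auto

text \<open>Two of the three terms cancel: \<open>(y + 1, y, z)\<close> has boundary
  \<open>g y (y - 1)\<close> and \<open>(x, z + 1, z)\<close> has boundary
  \<open>g (z + 1) z\<close>, both differences of degenerate pairs.\<close>

lemma keys_D_boundary_3:
  assumes "keys c \<subseteq> D_tuples m 3"
  shows "keys (YB_boundary m 3 c) \<subseteq> D_tuples m 2"
proof -
  have "keys (g (y + 1) y) \<subseteq> D_tuples m 2" for y
    using keys_e2_D[of y] keys_e2_D[of "y + 1"] by (simp add: g_def keys_diff_subset)
  note g_D = this this[of "y - 1" for y, simplified]
  show ?thesis
    using assms
    by (induction c rule: D_chain3_induct)
      (simp_all add: YB_boundary_diff YB_boundary_e3 g_D keys_diff_subset)
qed

lemma aug_boundary_3: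
  assumes "keys c \<subseteq> YB_tuples m 3"
  shows "aug (YB_boundary m 3 c) = 0"
  using assms
  by (induction c rule: chain3_induct)
    (simp_all add: YB_boundary_diff YB_boundary_e3 weighted_sum_simps)

lemma degenerate_reduction:
  "\<exists>e. keys e \<subseteq> D_tuples m 3 \<and> e2 (int k + 1) (int k) - e2 1 0 = YB_boundary m 3 e"
proof (induction k)
  case 0
  show ?case by (rule exI[of _ 0]) simp
next
  case (Suc k)
  then obtain e where e: "keys e \<subseteq> D_tuples m 3"
    "e2 (int k + 1) (int k) - e2 1 0 = YB_boundary m 3 e" by blast
  \<comment> \<open>This triple is degenerate, and its boundary is \<open>g (k + 1) k\<close>, the
    difference of two consecutive degenerate pairs.\<close>
  let ?t = "e3 0 (int k + 1) (int k)"
  have "e2 (int (Suc k) + 1) (int (Suc k)) - e2 1 0 = YB_boundary m 3 (e - ?t)"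
    unfolding YB_boundary_diff e(2)[symmetric] by (simp add: YB_boundary_e3 g_def algebra_simps)
  moreover from e keys_e3_D[of 0 "int k"] have "keys (e - ?t) \<subseteq> D_tuples m 3"
    by (simp add: keys_diff_subset)
  ultimately show ?case by blast
qed

lemma D_chain2_reduction:
  assumes "keys c \<subseteq> D_tuples m 2"
  shows "\<exists>e. keys e \<subseteq> D_tuples m 3 \<and> c - frag_cmul (aug c) (e2 1 0) = YB_boundary m 3 e"
  using assms
proof (induction c rule: D_chain2_induct)
  case zero
  show ?case by (rule exI[of _ 0]) simp
next
  case (one y)
  have "e2 (y mod int m + 1) (y mod int m) = e2 (y + 1) y"
    by (simp add: e2_def mod_simps)
  with degenerate_reduction[of "nat (y mod int m)"] mod_in_range[of y] show ?case by simp
next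
  case (diff a b)
  then obtain d e where
    d: "keys d \<subseteq> D_tuples m 3" "a - frag_cmul (aug a) (e2 1 0) = YB_boundary m 3 d" and
    e: "keys e \<subseteq> D_tuples m 3" "b - frag_cmul (aug b) (e2 1 0) = YB_boundary m 3 e" by blast
  have "a - b - frag_cmul (aug (a - b)) (e2 1 0) = YB_boundary m 3 (d - e)"
    unfolding YB_boundary_diff d(2)[symmetric] e(2)[symmetric]
    by (simp add: weighted_sum_simps frag_cmul_diff_distrib)
  moreover have "keys (d - e) \<subseteq> D_tuples m 3"
    using d e by (simp add: keys_diff_subset)
  ultimately show ?case by blast
qed

theorem H_D_2: "H_D 2 m \<cong> integer_group"
proof (rule H_D_iso(1)[where \<phi> = aug])
  have "k \<in> aug ` {x. keys x \<subseteq> D_tuples m 2 \<and> YB_boundary m 2 x = 0}" for k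
  proof -
    have k: "keys (frag_cmul k (e2 1 0)) \<subseteq> D_tuples m 2"
      using keys_e2_D[of 0] by (simp add: keys_cmul_subset)
    with YB_boundary_2_D[OF k] show ?thesis
      by (intro image_eqI[of _ _ "frag_cmul k (e2 1 0)"]) (simp_all add: weighted_sum_simps)
  qed
  then show "aug ` {x. keys x \<subseteq> D_tuples m 2 \<and> YB_boundary m 2 x = 0} = carrier integer_group"
    by auto
  show "aug x = \<one>\<^bsub>integer_group\<^esub> \<longleftrightarrow>
      (\<exists>e. keys e \<subseteq> D_tuples m (2 + 1) \<and> x = YB_boundary m (2 + 1) e)"
    if "keys x \<subseteq> D_tuples m 2" for x
  proof
    assume "aug x = \<one>\<^bsub>integer_group\<^esub>"
    then show "\<exists>e. keys e \<subseteq> D_tuples m (2 + 1) \<and> x = YB_boundary m (2 + 1) e"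
      using D_chain2_reduction[OF that] by simp
  next
    assume "\<exists>e. keys e \<subseteq> D_tuples m (2 + 1) \<and> x = YB_boundary m (2 + 1) e"
    then show "aug x = \<one>\<^bsub>integer_group\<^esub>"
      using D_tuples_subset[of m 3] by (auto intro!: aug_boundary_3)
  qed
  show "keys (YB_boundary m (2 + 1) c) \<subseteq> D_tuples m 2" if "keys c \<subseteq> D_tuples m (2 + 1)" for c
    using keys_D_boundary_3[of c] that by simp
  then show "YB_boundary m 2 (YB_boundary m (2 + 1) e) = 0" if "keys e \<subseteq> D_tuples m (2 + 1)" for e
    using that by (intro YB_boundary_2_D)
qed (simp_all add: YB_boundary_2_D weighted_sum_simps)

section \<open>The quotient complex in degree two\<close>

lemma coord_degenerate:
  assumes "keys c \<subseteq> D_tuples m 2" and "Suc j < m"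
  shows "coord (Suc j) c = 0"
proof -
  \<comment> \<open>Degenerate pairs lie on diagonal \<open>0\<close>, whose weight in
    \<open>diag_sum\<close> is 0, so the coordinates with positive index pass to the
    quotient.\<close>
  have "diag_count (Suc j) c = 0 \<and> diag_sum c = 0"
    using assms(1) by (induction c rule: D_chain2_induct) (simp_all add: diag_simps)
  then show ?thesis by (simp add: coord_def)
qed

theorem H_NYB_2: "H_NYB 2 m \<cong> integer_power_group (m - 1)"
proof (rule H_NYB_iso[where \<phi> = "\<lambda>c. \<lambda>j\<in>{..<m - 1}. coord (Suc j) c", OF m_pos])
  \<comment> \<open>There are no degenerate chains in degree one, so cycles of the quotient are
    represented by ordinary cycles.\<close>
  have D1: "keys c \<subseteq> D_tuples m (2 - 1) \<longleftrightarrow> c = 0" for c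
    by (simp add: D_tuples_1)
  show "group (integer_power_group (m - 1))" by simp
  show "(\<lambda>j\<in>{..<m - 1}. coord (Suc j) (x + y)) = (\<lambda>j\<in>{..<m - 1}. coord (Suc j) x)
      \<otimes>\<^bsub>integer_power_group (m - 1)\<^esub> (\<lambda>j\<in>{..<m - 1}. coord (Suc j) y)"
    if "keys x \<subseteq> YB_tuples m 2" "keys (YB_boundary m 2 x) \<subseteq> D_tuples m (2 - 1)"
      "keys y \<subseteq> YB_tuples m 2" "keys (YB_boundary m 2 y) \<subseteq> D_tuples m (2 - 1)" for x y
    using that unfolding D1 by (simp add: coord_add fun_eq_iff)
  show "(\<lambda>c. \<lambda>j\<in>{..<m - 1}. coord (Suc j) c)
      ` {x. keys x \<subseteq> YB_tuples m 2 \<and> keys (YB_boundary m 2 x) \<subseteq> D_tuples m (2 - 1)}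
      = carrier (integer_power_group (m - 1))"
    unfolding D1
  proof
    show "carrier (integer_power_group (m - 1)) \<subseteq> (\<lambda>c. \<lambda>j\<in>{..<m - 1}. coord (Suc j) c)
        ` {x. keys x \<subseteq> YB_tuples m 2 \<and> YB_boundary m 2 x = 0}"
    proof
      fix v :: "nat \<Rightarrow> int" assume "v \<in> carrier (integer_power_group (m - 1))"
      then have "v \<in> extensional {..<m - 1}" by (simp add: PiE_def)
      \<comment> \<open>Coordinate 0, which is lost in the quotient, is set to 0, and
        \<open>v\<close> is moved up by one index.\<close>
      then have "v = (\<lambda>j\<in>{..<m - 1}. coord (Suc j) (cycle_of (case_nat 0 v)))"
        by (intro extensionalityI[of _ "{..<m - 1}"]) (simp_all add: coord_cycle_of)
      then show "v \<in> (\<lambda>c. \<lambda>j\<in>{..<m - 1}. coord (Suc j) c)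
          ` {x. keys x \<subseteq> YB_tuples m 2 \<and> YB_boundary m 2 x = 0}"
        using cycle_of by (intro image_eqI[of _ _ "cycle_of (case_nat 0 v)"]) auto
    qed
  qed (intro image_subsetI, simp add: restrict_PiE_iff)
  show "keys (YB_boundary m 2 (YB_boundary m (2 + 1) e)) \<subseteq> D_tuples m (2 - 1)"
    if "keys e \<subseteq> YB_tuples m (2 + 1)" for e
    using that by (simp add: YB_boundary_2_3)
  show "(\<lambda>j\<in>{..<m - 1}. coord (Suc j) x) = \<one>\<^bsub>integer_power_group (m - 1)\<^esub> \<longleftrightarrow>
      (\<exists>e. keys e \<subseteq> YB_tuples m (2 + 1) \<and> keys (x - YB_boundary m (2 + 1) e) \<subseteq> D_tuples m 2)"
    if "keys x \<subseteq> YB_tuples m 2" "keys (YB_boundary m 2 x) \<subseteq> D_tuples m (2 - 1)" for x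
  proof
    have x: "keys x \<subseteq> YB_tuples m 2" "YB_boundary m 2 x = 0"
      using that unfolding D1 by simp_all
    {
      assume eq: "(\<lambda>j\<in>{..<m - 1}. coord (Suc j) x) = \<one>\<^bsub>integer_power_group (m - 1)\<^esub>"
      have zero: "coord j x = 0" if "0 < j" "j < m" for j
      proof -
        have "j - 1 < m - 1" "Suc (j - 1) = j" using that by simp_all
        then show ?thesis using fun_cong[OF eq, of "j - 1"] by (simp del: One_nat_def)
      qed
      \<comment> \<open>The pair \<open>(1, 0)\<close> is a degenerate cycle with coordinate 0 equal
        to 1 and all higher coordinates zero; adding this multiple removes the one coordinate of
        \<open>x\<close> that may be nonzero.\<close>
      let ?d = "frag_cmul (- coord 0 x) (e2 (0 + 1) 0)"
      have d: "keys ?d \<subseteq> D_tuples m 2"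
        by (intro keys_cmul_subset keys_e2_D)
      then have d': "keys ?d \<subseteq> YB_tuples m 2" "YB_boundary m 2 ?d = 0"
        using D_tuples_subset[of m 2] YB_boundary_2_D by blast+
      have "coord 0 ?d = - coord 0 x"
        by (simp add: coord_def diag_simps)
      then have "coord j (x + ?d) = 0" if "j < m" for j
        using zero[of j] coord_degenerate[OF d, of "j - 1"] that coord_add[OF x d', of j]
        by (cases "j = 0") simp_all
      then have "x + ?d \<in> boundaries 3"
        using x d' by (intro cycle_in_boundaries_3I) (simp_all add: keys_add_subset YB_boundary_add)
      then obtain e where e: "keys e \<subseteq> YB_tuples m 3" "x + ?d = YB_boundary m 3 e" by blast
      have "x - YB_boundary m 3 e = - ?d"
        unfolding e(2)[symmetric] by simp
      then have "keys (x - YB_boundary m 3 e) \<subseteq> D_tuples m 2"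
        using d by (simp only: keys_minus)
      with e(1) show "\<exists>e. keys e \<subseteq> YB_tuples m (2 + 1) \<and>
          keys (x - YB_boundary m (2 + 1) e) \<subseteq> D_tuples m 2"
        by (intro exI[of _ e]) simp
    }
    assume "\<exists>e. keys e \<subseteq> YB_tuples m (2 + 1) \<and> keys (x - YB_boundary m (2 + 1) e) \<subseteq> D_tuples m 2"
    then obtain e where e: "keys e \<subseteq> YB_tuples m 3" "keys (x - YB_boundary m 3 e) \<subseteq> D_tuples m 2"
      by auto
    have e': "keys (YB_boundary m 3 e) \<subseteq> YB_tuples m 2" "YB_boundary m 2 (YB_boundary m 3 e) = 0"
      using e by (simp_all add: keys_YB_boundary_3 YB_boundary_2_3)
    \<comment> \<open>Here \<open>x\<close> is a sum of two cycles, a boundary and a degenerate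
      chain, and on both the coordinate vanishes.\<close>
    have "coord (Suc j) x = 0" if "j < m - 1" for j
      using coord_add[of "YB_boundary m 3 e" "x - YB_boundary m 3 e" "Suc j"] e e'
        coord_degenerate[OF e(2), of j] that D_tuples_subset[of m 2] YB_boundary_2_D[OF e(2)]
      by (simp add: coord_boundary)
    then show "(\<lambda>j\<in>{..<m - 1}. coord (Suc j) x) = \<one>\<^bsub>integer_power_group (m - 1)\<^esub>"
      by (simp add: fun_eq_iff)
  qed
  show "keys (YB_boundary m (2 + 1) c) \<subseteq> D_tuples m 2" if "keys c \<subseteq> D_tuples m (2 + 1)" for c
    using keys_D_boundary_3[of c] that by simp
qed (simp add: YB_boundary_2_D)

end

theorem mainTheorem5:
  fixes m :: nat
  assumes "0 < m"
  shows "H_YB 1 m \<cong> integer_group \<times>\<times> integer_mod_group m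
       \<and> trivial_group (H_D 1 m)
       \<and> H_NYB 1 m \<cong> integer_group \<times>\<times> integer_mod_group m
       \<and> H_YB 2 m \<cong> integer_power_group m
       \<and> H_D 2 m \<cong> integer_group
       \<and> H_NYB 2 m \<cong> integer_power_group (m - 1)"
proof -
  interpret cyclic_biquandle m by standard (rule assms)
  show ?thesis
    using H_YB_1 H_D_1 H_NYB_1 H_YB_2 H_D_2 H_NYB_2 by blast
qed

end
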